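(* Let $(\mathcal{P},\eta,\dagger)$ be a Kleisli triple on $\mathbf{DCPO}$ that arrives at $\mathbf{DCPO}\mathbb{T}$ by an approach $R$, and let (i) $\mathcal{P}^*L=cl^{(\mathbb{T},\Omega)}_{R\mathcal{P}L}(\eta_L(L))$ for each dcpo $L$, (ii) $\eta^*_L$ be the co-restriction of $\eta_L$ to $\mathcal{P}^*L$, (iii) for a Scott continuous $f:L\rightarrow\mathcal{P}^*M$, $f^{\dagger *}:\mathcal{P}^*L\rightarrow\mathcal{P}^*M$ be the restriction and co-restriction of $(inc^*_M\circ f)^\dagger$, where $inc^*_M:\mathcal{P}^*M\rightarrow\mathcal{P}M$ is the inclusion map, (iv) the interpretation of $R^*\mathcal{P}^*L$ be induced by that of $R\mathcal{P}L$, and $R^*f^{\dagger *}=f^{\dagger *}$. Then $(\mathcal{P}^*,\eta^*,\dagger* )$ is a Kleisli triple on $\mathbf{DCPO}$ that arrives at $\mathbf{DCPO}(\mathbb{T},\Omega)$ by the approach $R^*$. Moreover, if $(\mathcal{P},\eta,\dagger)$ is strong with strength $t$, then $\mathcal{P}^*$ is strong, with strength $t^*_{A,B}:A\times\mathcal{P}^*(B)\rightarrow\mathcal{P}^*(A\times B)$ being exactly the restriction and co-restriction of $t_{A,B}$.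
   Context: Fix a $D$-algebraic theory $\mathbb{T}=(\Sigma_0,\Sigma_1,\lvert\cdot\rvert,M,\theta,\Lambda)$: $\Sigma_0,\Sigma_1$ disjoint sets of operators with arities $\lvert\cdot\rvert$, $M$ a set of dcpos, $\theta$ assigning to each argument slot of an operator $g\in\Sigma_1$ either a dcpo of $M$ or $*$ (the carrier), and $\Lambda$ a set of equational/inequational laws. $\mathbf{DCPO}\mathbb{T}$ is the category of dcpos $L$ with Scott continuous total operations interpreting the operators and obeying the laws, with Scott continuous operation-preserving maps. Fix an order bound system $\Omega$ of $\mathbb{T}$: for each $f\in\Sigma_0$ a functor $\Omega^f:\mathbf{POS}\rightarrow\mathbf{SET}$ with $\Omega^fP\subseteq\prod^{\lvert f\rvert}P$, $\prod^{\lvert f\rvert}h(\Omega^fP)\subseteq\Omega^fQ$ for order-preserving $h:P\rightarrow Q$, and $\Omega^fh$ the restriction of $\prod^{\lvert f\rvert}h$. $\mathbf{DCPO}(\mathbb{T},\Omega)$ is the category of dcpos $L$ where each $f\in\Sigma_0$ is interpreted as a partial operation defined exactly on tuples in $\Omega^fL$ and partially Scott continuous there, each $g\in\Sigma_1$ is Scott continuous, and the laws hold whenever all occurrences of operations act on admissible tuples; morphisms are Scott continuous maps preserving the operations on admissible tuples. For an object $(L,i)$ of $\mathbf{DCPO}(\mathbb{T},\Omega)$ (in particular an object of $\mathbf{DCPO}\mathbb{T}$), a sub o.b.d.algebra is a subdcpo $S$ with $i(f)(\Omega^fS)\subseteq S$ for all $f\in\Sigma_0$ and $i(g)$ mapping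 tuples whose carrier-arguments lie in $S$ into $S$ for all $g\in\Sigma_1$; sub o.b.d.algebras are closed under nonempty intersections, $cl^{(\mathbb{T},\Omega)}_{(L,i)}(S)$ denotes the least sub o.b.d.algebra containing $S$, and it is itself an object of $\mathbf{DCPO}(\mathbb{T},\Omega)$ with the induced operations. A Kleisli triple $(\mathcal{P},\eta,\dagger)$ on $\mathbf{DCPO}$ satisfies $\eta^\dagger_A=id$, $f^\dagger\circ\eta_A=f$, $f^\dagger\circ g^\dagger=(f^\dagger\circ g)^\dagger$. It arrives at a subcategory $\mathbf{D}$ by an approach $R$ if $R$ makes each $\mathcal{P}A$ an object $R\mathcal{P}A$ of $\mathbf{D}$ with underlying object $\mathcal{P}A$, and each $f^\dagger$ a morphism $Rf^\dagger$ of $\mathbf{D}$ with underlying map $f^\dagger$. A Kleisli triple/monad is strong (Moggi) if there is a natural transformation $t_{A,B}:A\times\mathcal{P}B\rightarrow\mathcal{P}(A\times B)$ satisfying the usual four coherence laws; on $\mathbf{DCPO}$ every monad is strong with $t_{A,B}(a,u)=\mathcal{P}(\lambda b.(a,b))(u)$. *)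

theory Defs
  imports "HOL-Library.FuncSet"
begin

section \<open>Dcpos and Scott continuous maps\<close>

text \<open>
  A poset is a relation r that is a partial order on its own field; Field r is the carrier.
  Hence the order induced on a subset S of the carrier is Restr r S, and equal posets are
  equal relations.  The empty poset is allowed.
\<close>

definition directed_in :: "'a rel \<Rightarrow> 'a set \<Rightarrow> bool" where
  "directed_in r D \<longleftrightarrow>
     D \<noteq> {} \<and> D \<subseteq> Field r \<and> (\<forall>x\<in>D. \<forall>y\<in>D. \<exists>z\<in>D. (x, z) \<in> r \<and> (y, z) \<in> r)"

definition is_supremum :: "'a rel \<Rightarrow> 'a set \<Rightarrow> 'a \<Rightarrow> bool" where
  "is_supremum r D s \<longleftrightarrow>
     s \<in> Field r \<and> (\<forall>x\<in>D. (x, s) \<in> r) \<and> (\<forall>u\<in>Field r. (\<forall>x\<in>D. (x, u) \<in> r) \<longrightarrow> (s, u) \<in> r)"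

definition dcpo :: "'a rel \<Rightarrow> bool" where
  "dcpo r \<longleftrightarrow> Partial_order r \<and> (\<forall>D. directed_in r D \<longrightarrow> (\<exists>s. is_supremum r D s))"

text \<open>
  Partial Scott continuity with domain X: every directed supremum of points of X that (exists
  and) lies in X is preserved.  Applied to the directed sets {x, y} with x below y, this contains
  monotonicity on X.  Maps are extensional, so X is the exact domain of definition
  and equality of maps is equality of functions.
\<close>

definition scott_continuous_on :: "'a set \<Rightarrow> 'a rel \<Rightarrow> 'b rel \<Rightarrow> ('a \<Rightarrow> 'b) \<Rightarrow> bool" where
  "scott_continuous_on X A B f \<longleftrightarrow>
     X \<subseteq> Field A \<and> f \<in> X \<rightarrow>\<^sub>E Field B \<and>
     (\<forall>D s. directed_in A D \<and> D \<subseteq> X \<and> is_supremum A D s \<and> s \<in> X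
        \<longrightarrow> is_supremum B (f ` D) (f s))"

definition scott_maps :: "'a rel \<Rightarrow> 'b rel \<Rightarrow> ('a \<Rightarrow> 'b) set" where
  "scott_maps A B = {f. scott_continuous_on (Field A) A B f}"

definition subdcpo :: "'a rel \<Rightarrow> 'a set \<Rightarrow> bool" where
  "subdcpo L S \<longleftrightarrow>
     S \<subseteq> Field L \<and> (\<forall>D s. directed_in L D \<and> D \<subseteq> S \<and> is_supremum L D s \<longrightarrow> s \<in> S)"

text \<open>
  The categories POS and DCPO are formed relative to a universe: the carriers are the small
  subsets of a type, and pr encodes pairs, so that binary products stay within the
  type.  Nothing else is assumed of the universe.
\<close>

locale order_universe =
  fixes small :: "'u set \<Rightarrow> bool" and pr :: "'u \<times> 'u \<Rightarrow> 'u"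
  assumes inj_pr: "inj pr"
    and small_singleton: "small {x}"
    and small_subset: "small A \<Longrightarrow> B \<subseteq> A \<Longrightarrow> small B"
    and small_product: "small A \<Longrightarrow> small B \<Longrightarrow> small (pr ` (A \<times> B))"

definition POS :: "('u set \<Rightarrow> bool) \<Rightarrow> 'u rel set" where
  "POS small = {r. Partial_order r \<and> small (Field r)}"

definition DCPO :: "('u set \<Rightarrow> bool) \<Rightarrow> 'u rel set" where
  "DCPO small = {r. dcpo r \<and> small (Field r)}"

definition order_preserving :: "'a rel \<Rightarrow> 'b rel \<Rightarrow> ('a \<Rightarrow> 'b) \<Rightarrow> bool" where
  "order_preserving P Q h \<longleftrightarrow>
     h \<in> Field P \<rightarrow>\<^sub>E Field Q \<and> (\<forall>x y. (x, y) \<in> P \<longrightarrow> (h x, h y) \<in> Q)"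


section \<open>D-algebraic theories\<close>

text \<open>
  The sort None is the carrier, the sort Some D is the parameter dcpo D.
  Terms are built from sorted variables, constants denoting elements of parameter dcpos, and
  operators.  The constants allow laws that involve auxiliary functions on the parameters (such as
  associativity of a scalar action) to be given by the family of their instances.
\<close>

datatype ('f, 'i, 'u, 'v) opterm =
    Var "'u rel option" 'v
  | Const "'u rel" 'u
  | Op 'f "'i \<Rightarrow> ('f, 'i, 'u, 'v) opterm"

datatype ('f, 'i, 'u, 'v) law =
    Equation "('f, 'i, 'u, 'v) opterm" "('f, 'i, 'u, 'v) opterm"
  | Inequation "('f, 'i, 'u, 'v) opterm" "('f, 'i, 'u, 'v) opterm"

text \<open>The arity of an operator is its set of argument slots, {..<n} for an n-ary operator.\<close>

record ('f, 'i, 'u, 'v) dtheory =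
  Sigma0 :: "'f set"
  Sigma1 :: "'f set"
  arity :: "'f \<Rightarrow> 'i set"
  params :: "'u rel set"
  theta :: "'f \<Rightarrow> 'i \<Rightarrow> 'u rel option"
  laws :: "('f, 'i, 'u, 'v) law set"

definition slot_sort :: "('f, 'i, 'u, 'v) dtheory \<Rightarrow> 'f \<Rightarrow> 'i \<Rightarrow> 'u rel option" where
  "slot_sort T f k = (if f \<in> Sigma1 T then theta T f k else None)"

primrec has_sort ::
  "('f, 'i, 'u, 'v) dtheory \<Rightarrow> ('f, 'i, 'u, 'v) opterm \<Rightarrow> 'u rel option \<Rightarrow> bool" where
  "has_sort T (Var \<sigma> v) = (\<lambda>\<tau>. \<tau> = \<sigma> \<and> \<sigma> \<in> insert None (Some ` params T))"
| "has_sort T (Const D c) = (\<lambda>\<tau>. \<tau> = Some D \<and> D \<in> params T \<and> c \<in> Field D)"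
| "has_sort T (Op f ts) =
     (\<lambda>\<tau>. \<tau> = None \<and> f \<in> Sigma0 T \<union> Sigma1 T
        \<and> (\<forall>k\<in>arity T f. has_sort T (ts k) (slot_sort T f k)))"

primrec wf_law :: "('f, 'i, 'u, 'v) dtheory \<Rightarrow> ('f, 'i, 'u, 'v) law \<Rightarrow> bool" where
  "wf_law T (Equation l r) = (has_sort T l None \<and> has_sort T r None)"
| "wf_law T (Inequation l r) = (has_sort T l None \<and> has_sort T r None)"

definition d_algebraic_theory ::
  "('u set \<Rightarrow> bool) \<Rightarrow> ('f, 'i, 'u, 'v) dtheory \<Rightarrow> bool" where
  "d_algebraic_theory small T \<longleftrightarrow>
     Sigma0 T \<inter> Sigma1 T = {} \<and>
     params T \<subseteq> DCPO small \<and>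
     (\<forall>g\<in>Sigma1 T. \<forall>k\<in>arity T g. theta T g k \<in> insert None (Some ` params T)) \<and>
     (\<forall>l\<in>laws T. wf_law T l)"

definition sort_ord :: "'u rel \<Rightarrow> 'u rel option \<Rightarrow> 'u rel" where
  "sort_ord L \<sigma> = (case \<sigma> of None \<Rightarrow> L | Some D \<Rightarrow> D)"

text \<open>The argument tuples of an operator over L, and their componentwise order.\<close>

definition arg_tuples :: "('f, 'i, 'u, 'v) dtheory \<Rightarrow> 'f \<Rightarrow> 'u rel \<Rightarrow> ('i \<Rightarrow> 'u) set" where
  "arg_tuples T f L = (\<Pi>\<^sub>E k\<in>arity T f. Field (sort_ord L (slot_sort T f k)))"

definition arg_ord :: "('f, 'i, 'u, 'v) dtheory \<Rightarrow> 'f \<Rightarrow> 'u rel \<Rightarrow> ('i \<Rightarrow> 'u) rel" where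
  "arg_ord T f L =
     {(x, y). x \<in> arg_tuples T f L \<and> y \<in> arg_tuples T f L \<and>
              (\<forall>k\<in>arity T f. (x k, y k) \<in> sort_ord L (slot_sort T f k))}"

text \<open>A map of carriers acts on the carrier components and fixes the parameters.\<close>

definition map_args ::
  "('f, 'i, 'u, 'v) dtheory \<Rightarrow> 'f \<Rightarrow> ('u \<Rightarrow> 'u) \<Rightarrow> ('i \<Rightarrow> 'u) \<Rightarrow> ('i \<Rightarrow> 'u)" where
  "map_args T f h x =
     (\<lambda>k\<in>arity T f. case slot_sort T f k of None \<Rightarrow> h (x k) | Some D \<Rightarrow> x k)"


section \<open>Order bound systems and partial algebras\<close>

text \<open>
  The action of the functor on an arrow h is determined by its action on objects, being the
  restriction of the power of h; the functor laws are then automatic.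
\<close>

definition order_bound_system ::
  "('u set \<Rightarrow> bool) \<Rightarrow> ('f, 'i, 'u, 'v) dtheory \<Rightarrow> ('f \<Rightarrow> 'u rel \<Rightarrow> ('i \<Rightarrow> 'u) set) \<Rightarrow> bool"
where
  "order_bound_system small T \<Omega> \<longleftrightarrow>
     (\<forall>f\<in>Sigma0 T.
        (\<forall>P\<in>POS small. \<Omega> f P \<subseteq> (\<Pi>\<^sub>E k\<in>arity T f. Field P)) \<and>
        (\<forall>P\<in>POS small. \<forall>Q\<in>POS small. \<forall>h. order_preserving P Q h
           \<longrightarrow> (\<lambda>x. \<lambda>k\<in>arity T f. h (x k)) ` \<Omega> f P \<subseteq> \<Omega> f Q))"

definition admissible ::
  "('f, 'i, 'u, 'v) dtheory \<Rightarrow> ('f \<Rightarrow> 'u rel \<Rightarrow> ('i \<Rightarrow> 'u) set) \<Rightarrow> 'f \<Rightarrow> 'u rel \<Rightarrow> ('i \<Rightarrow> 'u) set"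
where
  "admissible T \<Omega> f L = (if f \<in> Sigma0 T then \<Omega> f L else arg_tuples T f L)"

type_synonym ('f, 'i, 'u) interp = "'f \<Rightarrow> ('i \<Rightarrow> 'u) \<Rightarrow> 'u"

primrec eval_term ::
  "('f, 'i, 'u, 'v) dtheory \<Rightarrow> ('f, 'i, 'u) interp \<Rightarrow> ('u rel option \<Rightarrow> 'v \<Rightarrow> 'u)
    \<Rightarrow> ('f, 'i, 'u, 'v) opterm \<Rightarrow> 'u" where
  "eval_term T I \<rho> (Var \<sigma> v) = \<rho> \<sigma> v"
| "eval_term T I \<rho> (Const D c) = c"
| "eval_term T I \<rho> (Op f ts) = I f (\<lambda>k\<in>arity T f. eval_term T I \<rho> (ts k))"

text \<open>
  All occurring variables denote elements of their sort and all occurrences of operators act on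
  admissible tuples.  Only the occurring variables matter, so an empty sort that a law does not
  mention does not make the law vacuous.
\<close>

primrec term_defined ::
  "('f, 'i, 'u, 'v) dtheory \<Rightarrow> ('f \<Rightarrow> 'u rel \<Rightarrow> ('i \<Rightarrow> 'u) set) \<Rightarrow> 'u rel \<Rightarrow> ('f, 'i, 'u) interp
    \<Rightarrow> ('u rel option \<Rightarrow> 'v \<Rightarrow> 'u) \<Rightarrow> ('f, 'i, 'u, 'v) opterm \<Rightarrow> bool" where
  "term_defined T \<Omega> L I \<rho> (Var \<sigma> v) = (\<rho> \<sigma> v \<in> Field (sort_ord L \<sigma>))"
| "term_defined T \<Omega> L I \<rho> (Const D c) = True"
| "term_defined T \<Omega> L I \<rho> (Op f ts) =
     ((\<forall>k\<in>arity T f. term_defined T \<Omega> L I \<rho> (ts k)) \<and>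
      (\<lambda>k\<in>arity T f. eval_term T I \<rho> (ts k)) \<in> admissible T \<Omega> f L)"

primrec obeys ::
  "('f, 'i, 'u, 'v) dtheory \<Rightarrow> ('f \<Rightarrow> 'u rel \<Rightarrow> ('i \<Rightarrow> 'u) set) \<Rightarrow> 'u rel \<Rightarrow> ('f, 'i, 'u) interp
    \<Rightarrow> ('f, 'i, 'u, 'v) law \<Rightarrow> bool" where
  "obeys T \<Omega> L I (Equation l r) =
     (\<forall>\<rho>. term_defined T \<Omega> L I \<rho> l \<and> term_defined T \<Omega> L I \<rho> r
        \<longrightarrow> eval_term T I \<rho> l = eval_term T I \<rho> r)"
| "obeys T \<Omega> L I (Inequation l r) =
     (\<forall>\<rho>. term_defined T \<Omega> L I \<rho> l \<and> term_defined T \<Omega> L I \<rho> r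
        \<longrightarrow> (eval_term T I \<rho> l, eval_term T I \<rho> r) \<in> L)"

text \<open>Objects and morphisms of the category of order bounded d-algebras.\<close>

definition obd_algebra ::
  "('u set \<Rightarrow> bool) \<Rightarrow> ('f, 'i, 'u, 'v) dtheory \<Rightarrow> ('f \<Rightarrow> 'u rel \<Rightarrow> ('i \<Rightarrow> 'u) set)
    \<Rightarrow> 'u rel \<Rightarrow> ('f, 'i, 'u) interp \<Rightarrow> bool" where
  "obd_algebra small T \<Omega> L I \<longleftrightarrow>
     L \<in> DCPO small \<and>
     (\<forall>f \<in> Sigma0 T \<union> Sigma1 T.
        scott_continuous_on (admissible T \<Omega> f L) (arg_ord T f L) L (I f)) \<and>
     (\<forall>l\<in>laws T. obeys T \<Omega> L I l)"

definition obd_morphism ::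
  "('f, 'i, 'u, 'v) dtheory \<Rightarrow> ('f \<Rightarrow> 'u rel \<Rightarrow> ('i \<Rightarrow> 'u) set)
    \<Rightarrow> 'u rel \<Rightarrow> ('f, 'i, 'u) interp \<Rightarrow> 'u rel \<Rightarrow> ('f, 'i, 'u) interp \<Rightarrow> ('u \<Rightarrow> 'u) \<Rightarrow> bool" where
  "obd_morphism T \<Omega> L I K J h \<longleftrightarrow>
     h \<in> scott_maps L K \<and>
     (\<forall>f \<in> Sigma0 T \<union> Sigma1 T. \<forall>x \<in> admissible T \<Omega> f L.
        h (I f x) = J f (map_args T f h x))"

text \<open>
  Total d-algebras: every tuple of arguments is admissible, so that partial Scott continuity is
  Scott continuity on the whole product of the argument dcpos.
\<close>

definition d_algebra ::
  "('u set \<Rightarrow> bool) \<Rightarrow> ('f, 'i, 'u, 'v) dtheory \<Rightarrow> 'u rel \<Rightarrow> ('f, 'i, 'u) interp \<Rightarrow> bool" where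
  "d_algebra small T = obd_algebra small T (arg_tuples T)"

definition d_morphism ::
  "('f, 'i, 'u, 'v) dtheory \<Rightarrow> 'u rel \<Rightarrow> ('f, 'i, 'u) interp \<Rightarrow> 'u rel \<Rightarrow> ('f, 'i, 'u) interp
    \<Rightarrow> ('u \<Rightarrow> 'u) \<Rightarrow> bool" where
  "d_morphism T = obd_morphism T (arg_tuples T)"

definition sub_obd_algebra ::
  "('f, 'i, 'u, 'v) dtheory \<Rightarrow> ('f \<Rightarrow> 'u rel \<Rightarrow> ('i \<Rightarrow> 'u) set) \<Rightarrow> 'u rel \<Rightarrow> ('f, 'i, 'u) interp
    \<Rightarrow> 'u set \<Rightarrow> bool" where
  "sub_obd_algebra T \<Omega> L I S \<longleftrightarrow>
     subdcpo L S \<and>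
     (\<forall>f\<in>Sigma0 T. I f ` \<Omega> f (Restr L S) \<subseteq> S) \<and>
     (\<forall>g\<in>Sigma1 T. I g ` arg_tuples T g (Restr L S) \<subseteq> S)"

definition obd_closure ::
  "('f, 'i, 'u, 'v) dtheory \<Rightarrow> ('f \<Rightarrow> 'u rel \<Rightarrow> ('i \<Rightarrow> 'u) set) \<Rightarrow> 'u rel \<Rightarrow> ('f, 'i, 'u) interp
    \<Rightarrow> 'u set \<Rightarrow> 'u set" where
  "obd_closure T \<Omega> L I S = \<Inter>{X. sub_obd_algebra T \<Omega> L I X \<and> S \<subseteq> X}"


section \<open>Kleisli triples, arrival and strength\<close>

text \<open>
  The extension dag A B f, for f from A to P B, is indexed by A and B since a
  function does not determine its source and target dcpo.
\<close>

definition kleisli_triple ::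
  "('u set \<Rightarrow> bool) \<Rightarrow> ('u rel \<Rightarrow> 'u rel) \<Rightarrow> ('u rel \<Rightarrow> 'u \<Rightarrow> 'u)
    \<Rightarrow> ('u rel \<Rightarrow> 'u rel \<Rightarrow> ('u \<Rightarrow> 'u) \<Rightarrow> 'u \<Rightarrow> 'u) \<Rightarrow> bool" where
  "kleisli_triple small P \<eta> dag \<longleftrightarrow>
     (\<forall>A\<in>DCPO small. P A \<in> DCPO small) \<and>
     (\<forall>A\<in>DCPO small. \<eta> A \<in> scott_maps A (P A)) \<and>
     (\<forall>A\<in>DCPO small. \<forall>B\<in>DCPO small. \<forall>f\<in>scott_maps A (P B).
        dag A B f \<in> scott_maps (P A) (P B)) \<and>
     (\<forall>A\<in>DCPO small. dag A A (\<eta> A) = (\<lambda>u\<in>Field (P A). u)) \<and>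
     (\<forall>A\<in>DCPO small. \<forall>B\<in>DCPO small. \<forall>f\<in>scott_maps A (P B).
        compose (Field A) (dag A B f) (\<eta> A) = f) \<and>
     (\<forall>A\<in>DCPO small. \<forall>B\<in>DCPO small. \<forall>C\<in>DCPO small.
        \<forall>g\<in>scott_maps A (P B). \<forall>f\<in>scott_maps B (P C).
          compose (Field (P A)) (dag B C f) (dag A B g)
            = dag A C (compose (Field A) (dag B C f) g))"

text \<open>
  Arrival at a concrete category over DCPO whose objects are pairs (L, I) satisfying
  obj and whose morphisms are the maps satisfying mor.  The approach
  R gives the structure of R P A over the underlying dcpo P A; it is
  indexed by A, so P A = P B does not force equal structures.  As the
  morphisms are maps, the morphism with underlying map dag A B f is dag A B f itself.
\<close>

definition arrives_at ::
  "('u set \<Rightarrow> bool) \<Rightarrow> ('u rel \<Rightarrow> 's \<Rightarrow> bool) \<Rightarrow> ('u rel \<Rightarrow> 's \<Rightarrow> 'u rel \<Rightarrow> 's \<Rightarrow> ('u \<Rightarrow> 'u) \<Rightarrow> bool)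
    \<Rightarrow> ('u rel \<Rightarrow> 'u rel) \<Rightarrow> ('u rel \<Rightarrow> 'u rel \<Rightarrow> ('u \<Rightarrow> 'u) \<Rightarrow> 'u \<Rightarrow> 'u) \<Rightarrow> ('u rel \<Rightarrow> 's) \<Rightarrow> bool"
where
  "arrives_at small obj mor P dag R \<longleftrightarrow>
     (\<forall>A\<in>DCPO small. obj (P A) (R A)) \<and>
     (\<forall>A\<in>DCPO small. \<forall>B\<in>DCPO small. \<forall>f\<in>scott_maps A (P B).
        mor (P A) (R A) (P B) (R B) (dag A B f))"

text \<open>Products in DCPO, with pairs encoded by pr.\<close>

definition prod_dcpo :: "('u \<times> 'u \<Rightarrow> 'u) \<Rightarrow> 'u rel \<Rightarrow> 'u rel \<Rightarrow> 'u rel" where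
  "prod_dcpo pr A B = {(pr (a, b), pr (a', b')) | a b a' b'. (a, a') \<in> A \<and> (b, b') \<in> B}"

definition prod_map ::
  "('u \<times> 'u \<Rightarrow> 'u) \<Rightarrow> 'u rel \<Rightarrow> 'u rel \<Rightarrow> ('u \<Rightarrow> 'u) \<Rightarrow> ('u \<Rightarrow> 'u) \<Rightarrow> 'u \<Rightarrow> 'u" where
  "prod_map pr A B f g =
     (\<lambda>z\<in>Field (prod_dcpo pr A B). pr (f (fst (inv pr z)), g (snd (inv pr z))))"

definition prod_snd :: "('u \<times> 'u \<Rightarrow> 'u) \<Rightarrow> 'u rel \<Rightarrow> 'u rel \<Rightarrow> 'u \<Rightarrow> 'u" where
  "prod_snd pr A B = (\<lambda>z\<in>Field (prod_dcpo pr A B). snd (inv pr z))"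

definition prod_assoc :: "('u \<times> 'u \<Rightarrow> 'u) \<Rightarrow> 'u rel \<Rightarrow> 'u rel \<Rightarrow> 'u rel \<Rightarrow> 'u \<Rightarrow> 'u" where
  "prod_assoc pr A B C =
     (\<lambda>z\<in>Field (prod_dcpo pr (prod_dcpo pr A B) C).
        case inv pr z of (y, c) \<Rightarrow> case inv pr y of (a, b) \<Rightarrow> pr (a, pr (b, c)))"

definition id_map :: "'a rel \<Rightarrow> 'a \<Rightarrow> 'a" where
  "id_map A = (\<lambda>x\<in>Field A. x)"

text \<open>Functor action and multiplication of the monad associated with a Kleisli triple.\<close>

definition kl_map ::
  "('u rel \<Rightarrow> 'u \<Rightarrow> 'u) \<Rightarrow> ('u rel \<Rightarrow> 'u rel \<Rightarrow> ('u \<Rightarrow> 'u) \<Rightarrow> 'u \<Rightarrow> 'u)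
    \<Rightarrow> 'u rel \<Rightarrow> 'u rel \<Rightarrow> ('u \<Rightarrow> 'u) \<Rightarrow> 'u \<Rightarrow> 'u" where
  "kl_map \<eta> dag A B h = dag A B (compose (Field A) (\<eta> B) h)"

definition kl_mult ::
  "('u rel \<Rightarrow> 'u rel) \<Rightarrow> ('u rel \<Rightarrow> 'u rel \<Rightarrow> ('u \<Rightarrow> 'u) \<Rightarrow> 'u \<Rightarrow> 'u) \<Rightarrow> 'u rel \<Rightarrow> 'u \<Rightarrow> 'u" where
  "kl_mult P dag A = dag (P A) A (id_map (P A))"

text \<open>
  Moggi's tensorial strength: typing, naturality in both arguments, and the laws for the unit
  object (any one-point dcpo {(c, c)}), associativity, unit and multiplication.
\<close>

definition is_strength ::
  "('u set \<Rightarrow> bool) \<Rightarrow> ('u \<times> 'u \<Rightarrow> 'u) \<Rightarrow> ('u rel \<Rightarrow> 'u rel) \<Rightarrow> ('u rel \<Rightarrow> 'u \<Rightarrow> 'u)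
    \<Rightarrow> ('u rel \<Rightarrow> 'u rel \<Rightarrow> ('u \<Rightarrow> 'u) \<Rightarrow> 'u \<Rightarrow> 'u) \<Rightarrow> ('u rel \<Rightarrow> 'u rel \<Rightarrow> 'u \<Rightarrow> 'u) \<Rightarrow> bool" where
  "is_strength small pr P \<eta> dag t \<longleftrightarrow>
     (\<forall>A\<in>DCPO small. \<forall>B\<in>DCPO small.
        t A B \<in> scott_maps (prod_dcpo pr A (P B)) (P (prod_dcpo pr A B))) \<and>
     (\<forall>A\<in>DCPO small. \<forall>A'\<in>DCPO small. \<forall>B\<in>DCPO small. \<forall>B'\<in>DCPO small.
        \<forall>f\<in>scott_maps A A'. \<forall>g\<in>scott_maps B B'.
          compose (Field (prod_dcpo pr A (P B)))
              (kl_map \<eta> dag (prod_dcpo pr A B) (prod_dcpo pr A' B') (prod_map pr A B f g)) (t A B)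
            = compose (Field (prod_dcpo pr A (P B)))
                (t A' B') (prod_map pr A (P B) f (kl_map \<eta> dag B B' g))) \<and>
     (\<forall>c. \<forall>A\<in>DCPO small.
        compose (Field (prod_dcpo pr {(c, c)} (P A)))
            (kl_map \<eta> dag (prod_dcpo pr {(c, c)} A) A (prod_snd pr {(c, c)} A)) (t {(c, c)} A)
          = prod_snd pr {(c, c)} (P A)) \<and>
     (\<forall>A\<in>DCPO small. \<forall>B\<in>DCPO small. \<forall>C\<in>DCPO small.
        compose (Field (prod_dcpo pr (prod_dcpo pr A B) (P C)))
            (kl_map \<eta> dag (prod_dcpo pr (prod_dcpo pr A B) C) (prod_dcpo pr A (prod_dcpo pr B C))
               (prod_assoc pr A B C))
            (t (prod_dcpo pr A B) C)
          = compose (Field (prod_dcpo pr (prod_dcpo pr A B) (P C)))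
              (t A (prod_dcpo pr B C))
              (compose (Field (prod_dcpo pr (prod_dcpo pr A B) (P C)))
                 (prod_map pr A (prod_dcpo pr B (P C)) (id_map A) (t B C))
                 (prod_assoc pr A B (P C)))) \<and>
     (\<forall>A\<in>DCPO small. \<forall>B\<in>DCPO small.
        compose (Field (prod_dcpo pr A B)) (t A B) (prod_map pr A B (id_map A) (\<eta> B))
          = \<eta> (prod_dcpo pr A B)) \<and>
     (\<forall>A\<in>DCPO small. \<forall>B\<in>DCPO small.
        compose (Field (prod_dcpo pr A (P (P B))))
            (t A B) (prod_map pr A (P (P B)) (id_map A) (kl_mult P dag B))
          = compose (Field (prod_dcpo pr A (P (P B))))
              (kl_mult P dag (prod_dcpo pr A B))
              (compose (Field (prod_dcpo pr A (P (P B))))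
                 (kl_map \<eta> dag (prod_dcpo pr A (P B)) (P (prod_dcpo pr A B)) (t A B))
                 (t A (P B))))"

end

theory Submission
  imports Defs
begin

text \<open>
  The preimage of a sub o.b.d.algebra under a morphism of d-algebras is again a sub o.b.d.algebra.
  Hence the extension of f, being such a morphism, maps the closure of the units into that of the
  target as soon as f takes its values there; the extension restricts, and with it all Kleisli laws.
  A strength is no extra datum: since DCPO is well-pointed, a Scott continuous family t is a strength
  if and only if t A B (a, u) is the functor action of b \<mapsto> (a, b) on u.  This description is stable
  under restriction to the closures.
\<close>

section \<open>Dcpos and subdcpos\<close>

text \<open>Admissibility is computed in the induced poset \<open>Restr L S\<close>, not in
  \<open>L\<close>. If, say, \<open>\<Omega> f P\<close> consists of the pairs bounded in
  \<open>P\<close>, two elements of \<open>S\<close> may have a bound in \<open>L\<close> and none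
  in \<open>S\<close>. Being closed under the operations is therefore no condition on tuples of
  \<open>L\<close> alone, and admissible tuples are compared only along order-preserving maps: the
  inclusion of one subset into another handles intersections, and the morphism cut down to a
  preimage handles preimages. Totality of the operations on \<open>P L\<close> supplies the rest.
  Every tuple with entries in the subset has a value in \<open>P L\<close>, so the morphism
  equations, continuity and the laws of the total algebra are available for it and descend to the
  partial one. For the strength, the pointwise formula settles every equation but gives continuity
  only in \<open>u\<close> for fixed \<open>a\<close>. Joint continuity of the restricted family is
  therefore taken from the given \<open>t\<close>.\<close>

lemma dcpo_refl: "dcpo r \<Longrightarrow> Refl r"
  and dcpo_antisym: "dcpo r \<Longrightarrow> antisym r"
  and dcpo_trans: "dcpo r \<Longrightarrow> trans r"
  by (auto simp: dcpo_def partial_order_on_def preorder_on_def)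

lemma dcpo_reflD: "dcpo r \<Longrightarrow> x \<in> Field r \<Longrightarrow> (x, x) \<in> r"
  by (meson dcpo_refl refl_onD)

lemma is_supremum_unique:
  "antisym r \<Longrightarrow> is_supremum r D s \<Longrightarrow> is_supremum r D s' \<Longrightarrow> s = s'"
  unfolding is_supremum_def by (meson antisymD)

lemma directed_in_mono: "directed_in r D \<Longrightarrow> r \<subseteq> r' \<Longrightarrow> directed_in r' D"
  unfolding directed_in_def using mono_Field[of r r'] by blast

lemma directed_in_image:
  assumes "directed_in r D" and "\<And>x y. (x, y) \<in> r \<Longrightarrow> (f x, f y) \<in> r'"
  shows "directed_in r' (f ` D)"
  unfolding directed_in_def
proof (intro conjI ballI)
  show "f ` D \<noteq> {}" using assms(1) by (auto simp: directed_in_def)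
  have *: "\<And>x. x \<in> Field r \<Longrightarrow> f x \<in> Field r'"
    using assms(2) by (auto simp: Field_def)
  show "f ` D \<subseteq> Field r'" using assms(1) * by (auto simp: directed_in_def)
next
  fix u v assume "u \<in> f ` D" "v \<in> f ` D"
  then obtain x y where xy: "x \<in> D" "y \<in> D" "u = f x" "v = f y" by auto
  then obtain z where "z \<in> D" "(x, z) \<in> r" "(y, z) \<in> r"
    using assms(1) unfolding directed_in_def by blast
  then show "\<exists>w\<in>f ` D. (u, w) \<in> r' \<and> (v, w) \<in> r'" using xy assms(2) by blast
qed

lemma directed_in_Restr:
  assumes "dcpo L" "S \<subseteq> Field L"
  shows "directed_in (Restr L S) D \<longleftrightarrow> directed_in L D \<and> D \<subseteq> S"
  unfolding directed_in_def Refl_Field_Restr2[OF dcpo_refl[OF assms(1)] assms(2)]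
proof (intro iffI conjI ballI; (elim conjE)?)
  assume "D \<subseteq> S" and *: "\<forall>x\<in>D. \<forall>y\<in>D. \<exists>z\<in>D. (x, z) \<in> L \<and> (y, z) \<in> L"
  fix x y assume xy: "x \<in> D" "y \<in> D"
  then obtain z where "z \<in> D" "(x, z) \<in> L" "(y, z) \<in> L" using * by blast
  then show "\<exists>z\<in>D. (x, z) \<in> Restr L S \<and> (y, z) \<in> Restr L S"
    using xy \<open>D \<subseteq> S\<close> by blast
qed (use assms(2) in blast)+

lemma is_supremum_RestrI:
  assumes "dcpo L" "S \<subseteq> Field L" "is_supremum L D s" "D \<subseteq> S" "s \<in> S"
  shows "is_supremum (Restr L S) D s"
  using assms by (auto simp: is_supremum_def Refl_Field_Restr2 dcpo_refl)

lemma subdcpoD: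
  assumes "subdcpo L S"
  shows "S \<subseteq> Field L"
    and "directed_in L D \<Longrightarrow> D \<subseteq> S \<Longrightarrow> is_supremum L D s \<Longrightarrow> s \<in> S"
  using assms by (auto simp: subdcpo_def)

text \<open>The ambient supremum exists and is caught by \<open>S\<close>, so it is also least among
  the bounds in \<open>S\<close>; antisymmetry excludes any other supremum on either side.
  Continuity of restricted and co-restricted maps rests on this agreement.\<close>

lemma is_supremum_Restr:
  assumes L: "dcpo L" and S: "subdcpo L S" and D: "directed_in (Restr L S) D"
  shows "is_supremum (Restr L S) D s \<longleftrightarrow> is_supremum L D s"
proof -
  note SL = subdcpoD(1)[OF S]
  have D': "directed_in L D" "D \<subseteq> S" using D directed_in_Restr[OF L SL] by auto
  have *: "is_supremum (Restr L S) D u" if "is_supremum L D u" for u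
    using is_supremum_RestrI[OF L SL that D'(2)] subdcpoD(2)[OF S D' that] .
  obtain u where u: "is_supremum L D u" using L D'(1) by (auto simp: dcpo_def)
  have "antisym (Restr L S)" using dcpo_antisym[OF L] by (auto simp: antisym_def)
  then show ?thesis using is_supremum_unique * u by metis
qed

lemma dcpo_Restr:
  assumes L: "dcpo L" and S: "subdcpo L S"
  shows "dcpo (Restr L S)"
  unfolding dcpo_def
proof (intro conjI allI impI)
  show "Partial_order (Restr L S)"
    using L Partial_order_Restr by (auto simp: dcpo_def)
  fix D assume D: "directed_in (Restr L S) D"
  then have "directed_in L D" using directed_in_Restr[OF L subdcpoD(1)[OF S]] by simp
  then show "\<exists>s. is_supremum (Restr L S) D s"
    using L is_supremum_Restr[OF L S D] by (auto simp: dcpo_def)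
qed

lemma subdcpo_Field: "subdcpo L (Field L)"
  by (auto simp: subdcpo_def is_supremum_def)

text \<open>Presents the ambient poset as a restriction, so that results comparing two restrictions
  also compare \<open>Restr L S\<close> with \<open>L\<close>.\<close>

lemma Restr_Field_self: "Restr L (Field L) = L"
  by (auto simp: Field_def)

section \<open>Scott continuous maps\<close>

lemma scott_mapsI:
  assumes "f \<in> Field A \<rightarrow>\<^sub>E Field B"
    and "\<And>D s. directed_in A D \<Longrightarrow> is_supremum A D s \<Longrightarrow> is_supremum B (f ` D) (f s)"
  shows "f \<in> scott_maps A B"
  using assms by (auto simp: scott_maps_def scott_continuous_on_def)

lemma scott_maps_PiE: "f \<in> scott_maps A B \<Longrightarrow> f \<in> Field A \<rightarrow>\<^sub>E Field B"
  by (auto simp: scott_maps_def scott_continuous_on_def)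

lemma scott_maps_Field: "f \<in> scott_maps A B \<Longrightarrow> x \<in> Field A \<Longrightarrow> f x \<in> Field B"
  using scott_maps_PiE by fastforce

lemma scott_maps_extensional: "f \<in> scott_maps A B \<Longrightarrow> f \<in> extensional (Field A)"
  using scott_maps_PiE by (auto simp: PiE_def)

lemma scott_maps_supremum:
  "f \<in> scott_maps A B \<Longrightarrow> directed_in A D \<Longrightarrow> is_supremum A D s \<Longrightarrow> is_supremum B (f ` D) (f s)"
  unfolding scott_maps_def scott_continuous_on_def mem_Collect_eq
  by (metis is_supremum_def directed_in_def)

lemma scott_maps_mono:
  assumes A: "dcpo A" and f: "f \<in> scott_maps A B" and xy: "(x, y) \<in> A"
  shows "(f x, f y) \<in> B"
proof -
  have "x \<in> Field A" "y \<in> Field A" using xy by (auto simp: Field_def)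
  then have "(x, x) \<in> A" "(y, y) \<in> A" using dcpo_reflD[OF A] by auto
  then have "directed_in A {x, y}" "is_supremum A {x, y} y"
    using xy by (auto simp: directed_in_def is_supremum_def Field_def)
  from scott_maps_supremum[OF f this] show ?thesis by (auto simp: is_supremum_def)
qed

lemma scott_maps_order_preserving:
  "dcpo A \<Longrightarrow> f \<in> scott_maps A B \<Longrightarrow> order_preserving A B f"
  by (auto simp: order_preserving_def scott_maps_mono dest: scott_maps_PiE)

lemma scott_maps_directed:
  "dcpo A \<Longrightarrow> f \<in> scott_maps A B \<Longrightarrow> directed_in A D \<Longrightarrow> directed_in B (f ` D)"
  by (auto intro: directed_in_image scott_maps_mono)

lemma scott_maps_compose:
  assumes A: "dcpo A" and f: "f \<in> scott_maps A B" and g: "g \<in> scott_maps B C"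
  shows "compose (Field A) g f \<in> scott_maps A C"
proof (rule scott_mapsI)
  show "compose (Field A) g f \<in> Field A \<rightarrow>\<^sub>E Field C"
    using scott_maps_Field[OF f] scott_maps_Field[OF g] by (auto simp: compose_def)
next
  fix D s assume D: "directed_in A D" and s: "is_supremum A D s"
  have "is_supremum C (g ` f ` D) (g (f s))"
    by (intro scott_maps_supremum[OF g] scott_maps_directed[OF A f D] scott_maps_supremum[OF f D s])
  moreover have "compose (Field A) g f ` D = g ` f ` D"
    using D unfolding image_image
    by (intro image_cong refl) (auto simp: compose_def directed_in_def)
  moreover have "compose (Field A) g f s = g (f s)"
    using s by (simp add: compose_def is_supremum_def)
  ultimately show "is_supremum C (compose (Field A) g f ` D) (compose (Field A) g f s)" by simp
qed

lemma id_map_scott: "id_map A \<in> scott_maps A A"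
proof (rule scott_mapsI)
  fix D s assume D: "directed_in A D" and s: "is_supremum A D s"
  then have "id_map A ` D = D" "id_map A s = s"
    by (auto simp: id_map_def directed_in_def is_supremum_def subset_iff image_iff)
  then show "is_supremum A (id_map A ` D) (id_map A s)" using s by simp
qed (auto simp: id_map_def)

text \<open>Suprema in a subdcpo being ambient ones, the target can be cut down or enlarged freely.
  This turns typing questions about \<open>Ps\<close> into typing questions about \<open>P\<close>
  plus a range condition.\<close>

lemma scott_maps_Restr_iff:
  assumes A: "dcpo A" and B: "dcpo B" and S: "subdcpo B S"
  shows "f \<in> scott_maps A (Restr B S) \<longleftrightarrow> f \<in> scott_maps A B \<and> f ` Field A \<subseteq> S"
proof (intro iffI conjI)
  note SB = subdcpoD(1)[OF S]
  have F: "Field (Restr B S) = S" using Refl_Field_Restr2[OF dcpo_refl[OF B] SB] .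
  {
    assume f: "f \<in> scott_maps A (Restr B S)"
    show "f ` Field A \<subseteq> S" using scott_maps_Field[OF f] F by auto
    show "f \<in> scott_maps A B"
    proof (rule scott_mapsI)
      show "f \<in> Field A \<rightarrow>\<^sub>E Field B" using scott_maps_PiE[OF f] F SB by (auto simp: PiE_iff)
      fix D s assume D: "directed_in A D" and s: "is_supremum A D s"
      show "is_supremum B (f ` D) (f s)"
        using is_supremum_Restr[OF B S scott_maps_directed[OF A f D]] scott_maps_supremum[OF f D s]
        by simp
    qed
  }
  assume f: "f \<in> scott_maps A B \<and> f ` Field A \<subseteq> S"
  show "f \<in> scott_maps A (Restr B S)"
  proof (rule scott_mapsI)
    show "f \<in> Field A \<rightarrow>\<^sub>E Field (Restr B S)" 
      using f scott_maps_PiE[of f A B] F by (auto simp: PiE_iff)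
    fix D s assume D: "directed_in A D" and s: "is_supremum A D s"
    show "is_supremum (Restr B S) (f ` D) (f s)"
      using f D s by (intro is_supremum_RestrI[OF B SB] scott_maps_supremum[of f A B])
        (auto simp: directed_in_def is_supremum_def)
  qed
qed

lemma scott_maps_restrict:
  assumes A: "dcpo A" and S: "subdcpo A S" and f: "f \<in> scott_maps A B"
  shows "restrict f S \<in> scott_maps (Restr A S) B"
proof (rule scott_mapsI)
  note SA = subdcpoD(1)[OF S]
  have F: "Field (Restr A S) = S" using Refl_Field_Restr2[OF dcpo_refl[OF A] SA] .
  show "restrict f S \<in> Field (Restr A S) \<rightarrow>\<^sub>E Field B"
    unfolding F using scott_maps_Field[OF f] SA by auto
  fix D s assume D: "directed_in (Restr A S) D" and s: "is_supremum (Restr A S) D s"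
  have D': "directed_in A D" "D \<subseteq> S" using D directed_in_Restr[OF A SA] by auto
  have "s \<in> S" using s F by (auto simp: is_supremum_def)
  moreover have "is_supremum A D s" using s is_supremum_Restr[OF A S D] by simp
  moreover have "restrict f S ` D = f ` D" using D'(2) by (intro image_cong) auto
  ultimately show "is_supremum B (restrict f S ` D) (restrict f S s)"
    using scott_maps_supremum[OF f D'(1)] by simp
qed

lemma subdcpo_preimage:
  assumes A: "dcpo A" and S: "subdcpo B S" and f: "f \<in> scott_maps A B"
  shows "subdcpo A {x \<in> Field A. f x \<in> S}"
  unfolding subdcpo_def
proof (intro conjI allI impI, blast)
  fix D s assume *: "directed_in A D \<and> D \<subseteq> {x \<in> Field A. f x \<in> S} \<and> is_supremum A D s"
  then have "f s \<in> S"
    using subdcpoD(2)[OF S scott_maps_directed[OF A f] _ scott_maps_supremum[OF f]] by blast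
  then show "s \<in> {x \<in> Field A. f x \<in> S}" using * by (auto simp: is_supremum_def)
qed

text \<open>Nonemptiness keeps the intersection inside \<open>Field L\<close>: the empty
  intersection is the whole type.\<close>

lemma subdcpo_Inter:
  assumes "\<X> \<noteq> {}" "\<And>X. X \<in> \<X> \<Longrightarrow> subdcpo L X"
  shows "subdcpo L (\<Inter>\<X>)"
  using assms unfolding subdcpo_def by blast

section \<open>Products\<close>

context order_universe
begin

lemma pr_eq [simp]: "pr x = pr y \<longleftrightarrow> x = y"
  using inj_pr by (auto dest: injD)

lemma inv_pr [simp]: "inv pr (pr x) = x"
  using inj_pr by simp

lemma mem_prod_dcpo [simp]:
  "(pr (a, b), pr (a', b')) \<in> prod_dcpo pr A B \<longleftrightarrow> (a, a') \<in> A \<and> (b, b') \<in> B"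
  by (auto simp: prod_dcpo_def)

lemma prod_dcpo_cases:
  assumes "(z, z') \<in> prod_dcpo pr A B"
  obtains a b a' b' where "z = pr (a, b)" "z' = pr (a', b')" "(a, a') \<in> A" "(b, b') \<in> B"
  using assms by (auto simp: prod_dcpo_def)

text \<open>The reverse inclusion rests on reflexivity: otherwise one component might occur only as
  a lower end and the other only as an upper end, and their pair in no comparison at all.\<close>

lemma Field_prod_dcpo:
  assumes "Refl A" "Refl B"
  shows "Field (prod_dcpo pr A B) = pr ` (Field A \<times> Field B)"
proof
  show "Field (prod_dcpo pr A B) \<subseteq> pr ` (Field A \<times> Field B)"
    by (auto simp: Field_def prod_dcpo_def)
  show "pr ` (Field A \<times> Field B) \<subseteq> Field (prod_dcpo pr A B)"
  proof
    fix z assume "z \<in> pr ` (Field A \<times> Field B)"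
    then obtain a b where "z = pr (a, b)" "(a, a) \<in> A" "(b, b) \<in> B"
      using assms by (auto dest: refl_onD)
    then have "(z, z) \<in> prod_dcpo pr A B" by simp
    then show "z \<in> Field (prod_dcpo pr A B)" by (rule FieldI1)
  qed
qed

lemma is_supremum_prodI:
  assumes A: "dcpo A" and B: "dcpo B" and D: "D \<noteq> {}" "D \<subseteq> Field (prod_dcpo pr A B)"
    and a: "is_supremum A ((\<lambda>z. fst (inv pr z)) ` D) a"
    and b: "is_supremum B ((\<lambda>z. snd (inv pr z)) ` D) b"
  shows "is_supremum (prod_dcpo pr A B) D (pr (a, b))"
proof -
  note F = Field_prod_dcpo[OF dcpo_refl[OF A] dcpo_refl[OF B]]
  have D': "D \<subseteq> pr ` (Field A \<times> Field B)" using D F by simp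
  show ?thesis
    unfolding is_supremum_def F
  proof (intro conjI ballI impI)
    show "pr (a, b) \<in> pr ` (Field A \<times> Field B)" using a b by (auto simp: is_supremum_def)
    fix z assume "z \<in> D"
    moreover then obtain x y where "z = pr (x, y)" using D' by auto
    ultimately show "(z, pr (a, b)) \<in> prod_dcpo pr A B"
      using a b by (force simp: is_supremum_def)
  next
    fix u assume "u \<in> pr ` (Field A \<times> Field B)"
    then obtain x y where u: "u = pr (x, y)" "x \<in> Field A" "y \<in> Field B" by auto
    assume *: "\<forall>z\<in>D. (z, u) \<in> prod_dcpo pr A B"
    have "(fst (inv pr z), x) \<in> A \<and> (snd (inv pr z), y) \<in> B" if "z \<in> D" for z
      using D' that * u(1) by force
    then show "(pr (a, b), u) \<in> prod_dcpo pr A B"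
      using a b u by (auto simp: is_supremum_def)
  qed
qed

lemma fst_mono: "(z, z') \<in> prod_dcpo pr A B \<Longrightarrow> (fst (inv pr z), fst (inv pr z')) \<in> A"
  and snd_mono: "(z, z') \<in> prod_dcpo pr A B \<Longrightarrow> (snd (inv pr z), snd (inv pr z')) \<in> B"
  by (auto elim: prod_dcpo_cases)

lemma Partial_order_prod_dcpo:
  assumes A: "dcpo A" and B: "dcpo B"
  shows "Partial_order (prod_dcpo pr A B)"
proof -
  have "Refl (prod_dcpo pr A B)"
    using Field_prod_dcpo[OF dcpo_refl[OF A] dcpo_refl[OF B]] dcpo_refl[OF A] dcpo_refl[OF B]
    by (auto simp: refl_on_def)
  moreover have "trans (prod_dcpo pr A B)"
  proof (rule transI)
    fix x y z assume xy: "(x, y) \<in> prod_dcpo pr A B" and yz: "(y, z) \<in> prod_dcpo pr A B"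
    from xy obtain a b a' b' where 1: "x = pr (a, b)" "y = pr (a', b')" "(a, a') \<in> A" "(b, b') \<in> B"
      by (rule prod_dcpo_cases)
    from yz obtain a'' b'' where 2: "z = pr (a'', b'')" "(a', a'') \<in> A" "(b', b'') \<in> B"
      using 1(2) by (auto elim: prod_dcpo_cases)
    show "(x, z) \<in> prod_dcpo pr A B"
      using transD[OF dcpo_trans[OF A] 1(3) 2(2)] transD[OF dcpo_trans[OF B] 1(4) 2(3)] 1 2 by simp
  qed
  moreover have "antisym (prod_dcpo pr A B)"
    using dcpo_antisym[OF A] dcpo_antisym[OF B]
    by (auto simp: antisym_def elim!: prod_dcpo_cases)
  moreover have "prod_dcpo pr A B \<subseteq> Field (prod_dcpo pr A B) \<times> Field (prod_dcpo pr A B)"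
    by (meson FieldI1 FieldI2 SigmaI subrelI)
  ultimately show ?thesis by (simp add: partial_order_on_def preorder_on_def)
qed

lemma prod_dcpo_directed_supremum:
  assumes A: "dcpo A" and B: "dcpo B" and D: "directed_in (prod_dcpo pr A B) D"
  obtains a b where "is_supremum A ((\<lambda>z. fst (inv pr z)) ` D) a"
    "is_supremum B ((\<lambda>z. snd (inv pr z)) ` D) b"
    "is_supremum (prod_dcpo pr A B) D (pr (a, b))"
proof -
  have "directed_in A ((\<lambda>z. fst (inv pr z)) ` D)" "directed_in B ((\<lambda>z. snd (inv pr z)) ` D)"
    using D by (auto intro!: directed_in_image[OF D] fst_mono snd_mono)
  then obtain a b where "is_supremum A ((\<lambda>z. fst (inv pr z)) ` D) a"
    "is_supremum B ((\<lambda>z. snd (inv pr z)) ` D) b"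
    using A B unfolding dcpo_def by metis
  moreover from this have "is_supremum (prod_dcpo pr A B) D (pr (a, b))"
    using D by (intro is_supremum_prodI[OF A B]) (auto simp: directed_in_def)
  ultimately show ?thesis using that by blast
qed

lemma dcpo_prod_dcpo:
  assumes A: "dcpo A" and B: "dcpo B"
  shows "dcpo (prod_dcpo pr A B)"
  unfolding dcpo_def
  using Partial_order_prod_dcpo[OF A B] prod_dcpo_directed_supremum[OF A B] by metis

text \<open>A supremum is built from the componentwise suprema, which exist by completeness of the
  factors; uniqueness then identifies it with \<open>s\<close>.\<close>

lemma is_supremum_prodD:
  assumes A: "dcpo A" and B: "dcpo B" and D: "directed_in (prod_dcpo pr A B) D"
    and s: "is_supremum (prod_dcpo pr A B) D s"
  shows "is_supremum A ((\<lambda>z. fst (inv pr z)) ` D) (fst (inv pr s))"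
    and "is_supremum B ((\<lambda>z. snd (inv pr z)) ` D) (snd (inv pr s))"
proof -
  obtain a b where *: "is_supremum A ((\<lambda>z. fst (inv pr z)) ` D) a"
    "is_supremum B ((\<lambda>z. snd (inv pr z)) ` D) b"
    "is_supremum (prod_dcpo pr A B) D (pr (a, b))"
    by (rule prod_dcpo_directed_supremum[OF A B D])
  have "s = pr (a, b)"
    using is_supremum_unique[OF dcpo_antisym[OF dcpo_prod_dcpo[OF A B]] s *(3)] .
  with * show "is_supremum A ((\<lambda>z. fst (inv pr z)) ` D) (fst (inv pr s))"
    and "is_supremum B ((\<lambda>z. snd (inv pr z)) ` D) (snd (inv pr s))" by auto
qed

section \<open>Projections, pairing and the structural maps of products\<close>

definition prod_fst :: "'u rel \<Rightarrow> 'u rel \<Rightarrow> 'u \<Rightarrow> 'u" where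
  "prod_fst A B = (\<lambda>z\<in>Field (prod_dcpo pr A B). fst (inv pr z))"

text \<open>The universal map into the product. \<open>prod_map\<close>, \<open>prod_assoc\<close>
  and \<open>pair_with\<close> are rewritten as pairings of simpler continuous maps, so none of them
  needs its own computation of suprema.\<close>

definition pairing :: "'u rel \<Rightarrow> ('u \<Rightarrow> 'u) \<Rightarrow> ('u \<Rightarrow> 'u) \<Rightarrow> 'u \<Rightarrow> 'u" where
  "pairing C f g = (\<lambda>c\<in>Field C. pr (f c, g c))"

lemma prod_fst_scott:
  assumes A: "dcpo A" and B: "dcpo B"
  shows "prod_fst A B \<in> scott_maps (prod_dcpo pr A B) A"
proof (rule scott_mapsI)
  show "prod_fst A B \<in> Field (prod_dcpo pr A B) \<rightarrow>\<^sub>E Field A"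
    using Field_prod_dcpo[OF dcpo_refl[OF A] dcpo_refl[OF B]] by (auto simp: prod_fst_def)
  fix D s assume D: "directed_in (prod_dcpo pr A B) D" and s: "is_supremum (prod_dcpo pr A B) D s"
  have "prod_fst A B ` D = (\<lambda>z. fst (inv pr z)) ` D"
    using D by (intro image_cong) (auto simp: prod_fst_def directed_in_def)
  moreover have "prod_fst A B s = fst (inv pr s)" using s by (simp add: prod_fst_def is_supremum_def)
  ultimately show "is_supremum A (prod_fst A B ` D) (prod_fst A B s)"
    using is_supremum_prodD(1)[OF A B D s] by simp
qed

lemma prod_snd_scott:
  assumes A: "dcpo A" and B: "dcpo B"
  shows "prod_snd pr A B \<in> scott_maps (prod_dcpo pr A B) B"
proof (rule scott_mapsI)
  show "prod_snd pr A B \<in> Field (prod_dcpo pr A B) \<rightarrow>\<^sub>E Field B"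
    using Field_prod_dcpo[OF dcpo_refl[OF A] dcpo_refl[OF B]] by (auto simp: prod_snd_def)
  fix D s assume D: "directed_in (prod_dcpo pr A B) D" and s: "is_supremum (prod_dcpo pr A B) D s"
  have "prod_snd pr A B ` D = (\<lambda>z. snd (inv pr z)) ` D"
    using D by (intro image_cong) (auto simp: prod_snd_def directed_in_def)
  moreover have "prod_snd pr A B s = snd (inv pr s)" using s by (simp add: prod_snd_def is_supremum_def)
  ultimately show "is_supremum B (prod_snd pr A B ` D) (prod_snd pr A B s)"
    using is_supremum_prodD(2)[OF A B D s] by simp
qed

lemma pairing_scott:
  assumes C: "dcpo C" and A: "dcpo A" and B: "dcpo B"
    and f: "f \<in> scott_maps C A" and g: "g \<in> scott_maps C B"
  shows "pairing C f g \<in> scott_maps C (prod_dcpo pr A B)"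
proof (rule scott_mapsI)
  note F = Field_prod_dcpo[OF dcpo_refl[OF A] dcpo_refl[OF B]]
  show *: "pairing C f g \<in> Field C \<rightarrow>\<^sub>E Field (prod_dcpo pr A B)"
    unfolding F using scott_maps_Field[OF f] scott_maps_Field[OF g] by (auto simp: pairing_def)
  fix D s assume D: "directed_in C D" and s: "is_supremum C D s"
  have DC: "D \<subseteq> Field C" "D \<noteq> {}" using D by (auto simp: directed_in_def)
  have "(\<lambda>z. fst (inv pr z)) ` pairing C f g ` D = f ` D"
    "(\<lambda>z. snd (inv pr z)) ` pairing C f g ` D = g ` D"
    unfolding image_image using DC(1) by (auto intro!: image_cong simp: pairing_def)
  then have "is_supremum (prod_dcpo pr A B) (pairing C f g ` D) (pr (f s, g s))"
    using DC * scott_maps_supremum[OF f D s] scott_maps_supremum[OF g D s]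
    by (intro is_supremum_prodI[OF A B]) auto
  moreover have "pairing C f g s = pr (f s, g s)" using s by (simp add: pairing_def is_supremum_def)
  ultimately show "is_supremum (prod_dcpo pr A B) (pairing C f g ` D) (pairing C f g s)" by simp
qed

lemma const_scott: 
  assumes "dcpo A" "a \<in> Field A"
  shows "(\<lambda>x\<in>Field C. a) \<in> scott_maps C A"
proof (rule scott_mapsI)
  fix D s assume D: "directed_in C D" and s: "is_supremum C D s"
  then have "(\<lambda>x\<in>Field C. a) ` D = {a}" "(\<lambda>x\<in>Field C. a) s = a"
    by (auto simp: directed_in_def is_supremum_def image_iff subset_iff)
  then show "is_supremum A ((\<lambda>x\<in>Field C. a) ` D) ((\<lambda>x\<in>Field C. a) s)"
    using dcpo_reflD[OF assms] assms by (auto simp: is_supremum_def)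
qed (use assms in auto)

lemma prod_map_scott:
  assumes A: "dcpo A" "dcpo A'" and B: "dcpo B" "dcpo B'"
    and f: "f \<in> scott_maps A A'" and g: "g \<in> scott_maps B B'"
  shows "prod_map pr A B f g \<in> scott_maps (prod_dcpo pr A B) (prod_dcpo pr A' B')"
proof -
  let ?Z = "prod_dcpo pr A B"
  have "prod_map pr A B f g =
    pairing ?Z (compose (Field ?Z) f (prod_fst A B)) (compose (Field ?Z) g (prod_snd pr A B))"
    by (auto simp: prod_map_def pairing_def prod_fst_def prod_snd_def compose_def intro!: restrict_ext)
  then show ?thesis
    using A B f g
    by (auto intro!: pairing_scott scott_maps_compose[OF _ prod_fst_scott]
      scott_maps_compose[OF _ prod_snd_scott] dcpo_prod_dcpo)
qed

lemma prod_assoc_scott: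
  assumes A: "dcpo A" and B: "dcpo B" and C: "dcpo C"
  shows "prod_assoc pr A B C
    \<in> scott_maps (prod_dcpo pr (prod_dcpo pr A B) C) (prod_dcpo pr A (prod_dcpo pr B C))"
proof -
  let ?Y = "prod_dcpo pr A B"
  let ?Z = "prod_dcpo pr ?Y C"
  note Y = dcpo_prod_dcpo[OF A B]
  note Z = dcpo_prod_dcpo[OF Y C]
  note FY = Field_prod_dcpo[OF dcpo_refl[OF A] dcpo_refl[OF B]]
  note FZ = Field_prod_dcpo[OF dcpo_refl[OF Y] dcpo_refl[OF C]]
  let ?p = "prod_fst ?Y C"
  let ?a = "compose (Field ?Z) (prod_fst A B) ?p"
  let ?b = "compose (Field ?Z) (prod_snd pr A B) ?p"
  have "prod_assoc pr A B C = pairing ?Z ?a (pairing ?Z ?b (prod_snd pr ?Y C))"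
    unfolding prod_assoc_def pairing_def
    by (intro restrict_ext) (auto simp: FZ FY prod_fst_def prod_snd_def compose_def)
  moreover have p: "?p \<in> scott_maps ?Z ?Y" by (rule prod_fst_scott[OF Y C])
  ultimately show ?thesis
    using scott_maps_compose[OF Z p prod_fst_scott[OF A B]]
      scott_maps_compose[OF Z p prod_snd_scott[OF A B]] prod_snd_scott[OF Y C] A B C Z
    by (auto intro!: pairing_scott dcpo_prod_dcpo)
qed

definition pair_with :: "'u \<Rightarrow> 'u rel \<Rightarrow> 'u \<Rightarrow> 'u" where
  "pair_with a B = (\<lambda>b\<in>Field B. pr (a, b))"

lemma pair_with_scott:
  assumes A: "dcpo A" and B: "dcpo B" and a: "a \<in> Field A"
  shows "pair_with a B \<in> scott_maps B (prod_dcpo pr A B)"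
proof -
  have "pair_with a B = pairing B (\<lambda>x\<in>Field B. a) (id_map B)"
    by (auto simp: pair_with_def pairing_def id_map_def intro!: restrict_ext)
  then show ?thesis using pairing_scott[OF B A B const_scott[OF A a] id_map_scott] by simp
qed

text \<open>The set is the preimage of \<open>S\<close> under the second projection. Together with
  \<open>prod_dcpo_Restr\<close> this exhibits the source of the restricted strength as a sub of the
  source of \<open>t A B\<close>.\<close>

lemma subdcpo_prod_dcpo:
  assumes A: "dcpo A" and B: "dcpo B" and S: "subdcpo B S"
  shows "subdcpo (prod_dcpo pr A B) (pr ` (Field A \<times> S))"
proof -
  have "pr ` (Field A \<times> S) = {z \<in> Field (prod_dcpo pr A B). prod_snd pr A B z \<in> S}"
    using subdcpoD(1)[OF S] 
    by (auto simp: prod_snd_def Field_prod_dcpo[OF dcpo_refl[OF A] dcpo_refl[OF B]])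
  then show ?thesis
    using subdcpo_preimage[OF dcpo_prod_dcpo[OF A B] S prod_snd_scott[OF A B]] by simp
qed

lemma prod_dcpo_Restr:
  "prod_dcpo pr A (Restr B S) = Restr (prod_dcpo pr A B) (pr ` (Field A \<times> S))"
  by (auto simp: prod_dcpo_def Field_def; blast)

lemma DCPO_dcpo: "A \<in> DCPO small \<Longrightarrow> dcpo A"
  by (simp add: DCPO_def)

lemma DCPO_POS: "A \<in> DCPO small \<Longrightarrow> A \<in> POS small"
  by (simp add: DCPO_def POS_def dcpo_def)

lemma DCPO_prod_dcpo: "A \<in> DCPO small \<Longrightarrow> B \<in> DCPO small \<Longrightarrow> prod_dcpo pr A B \<in> DCPO small"
  by (simp add: DCPO_def dcpo_prod_dcpo Field_prod_dcpo dcpo_refl small_product)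

lemma DCPO_Restr:
  assumes L: "L \<in> DCPO small" and S: "subdcpo L S"
  shows "Restr L S \<in> DCPO small"
  using dcpo_Restr[OF DCPO_dcpo[OF L] S] small_subset[of "Field L" "Field (Restr L S)"] L
    mono_Field[of "Restr L S" L]
  by (auto simp: DCPO_def)

lemma DCPO_singleton: "{(c, c)} \<in> DCPO small"
proof -
  have "Partial_order {(c, c)}"
    by (auto simp: partial_order_on_def preorder_on_def refl_on_def trans_def antisym_def)
  moreover have "is_supremum {(c, c)} D c" if "directed_in {(c, c)} D" for D
    using that by (auto simp: directed_in_def is_supremum_def Field_def)
  moreover have "Field {(c, c)} = {c}" by (auto simp: Field_def)
  ultimately show ?thesis by (auto simp: DCPO_def dcpo_def small_singleton)
qed

end

section \<open>Order bounded d-algebras\<close>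

lemma is_supremum_arg_ordI:
  assumes "s \<in> arg_tuples T f L" "D \<subseteq> arg_tuples T f L" "D \<noteq> {}"
    and "\<And>k. k \<in> arity T f \<Longrightarrow>
      is_supremum (sort_ord L (slot_sort T f k)) ((\<lambda>x. x k) ` D) (s k)"
  shows "is_supremum (arg_ord T f L) D s"
proof -
  have le: "(x, s) \<in> arg_ord T f L" if "x \<in> D" for x
    using assms that by (auto simp: arg_ord_def is_supremum_def)
  moreover have "(s, u) \<in> arg_ord T f L"
    if u: "u \<in> Field (arg_ord T f L)" "\<forall>x\<in>D. (x, u) \<in> arg_ord T f L" for u
  proof -
    have "u \<in> arg_tuples T f L" using u(1) by (auto simp: arg_ord_def Field_def)
    moreover have "(s k, u k) \<in> sort_ord L (slot_sort T f k)" if k: "k \<in> arity T f" for k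
    proof -
      have "u k \<in> Field (sort_ord L (slot_sort T f k))"
        using \<open>u \<in> arg_tuples T f L\<close> k by (auto simp: arg_tuples_def)
      then show ?thesis
        using assms(4)[OF k] u(2) k by (auto simp: arg_ord_def is_supremum_def)
    qed
    ultimately show ?thesis using assms(1) by (auto simp: arg_ord_def)
  qed
  moreover have "s \<in> Field (arg_ord T f L)" using le assms(3) by (auto simp: Field_def)
  ultimately show ?thesis by (auto simp: is_supremum_def)
qed

text \<open>As for binary products: \<open>u\<close> collects the componentwise suprema and
  uniqueness forces \<open>s\<close> to be that tuple. Restricting \<open>u\<close> to the arity
  makes it extensional, and extensionality of tuples is also what makes their componentwise order
  antisymmetric.\<close>

lemma is_supremum_arg_ordD:
  assumes dcpos: "\<And>k. k \<in> arity T f \<Longrightarrow> dcpo (sort_ord L (slot_sort T f k))"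
    and D: "directed_in (arg_ord T f L) D" and s: "is_supremum (arg_ord T f L) D s"
    and k: "k \<in> arity T f"
  shows "is_supremum (sort_ord L (slot_sort T f k)) ((\<lambda>x. x k) ` D) (s k)"
proof -
  have "directed_in (sort_ord L (slot_sort T f j)) ((\<lambda>x. x j) ` D)" if "j \<in> arity T f" for j
    using that by (intro directed_in_image[OF D]) (auto simp: arg_ord_def)
  then have "\<forall>j\<in>arity T f. \<exists>u. is_supremum (sort_ord L (slot_sort T f j)) ((\<lambda>x. x j) ` D) u"
    using dcpos unfolding dcpo_def by blast
  then obtain u where u:
    "\<And>j. j \<in> arity T f \<Longrightarrow> is_supremum (sort_ord L (slot_sort T f j)) ((\<lambda>x. x j) ` D) (u j)"
    by metis
  let ?u = "restrict u (arity T f)"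
  have F: "Field (arg_ord T f L) \<subseteq> arg_tuples T f L" by (auto simp: arg_ord_def Field_def)
  have "?u \<in> arg_tuples T f L" using u by (auto simp: arg_tuples_def is_supremum_def)
  then have "is_supremum (arg_ord T f L) D ?u"
    using u D F by (intro is_supremum_arg_ordI) (auto simp: directed_in_def)
  moreover have "antisym (arg_ord T f L)"
  proof (rule antisymI)
    fix x y assume xy: "(x, y) \<in> arg_ord T f L" "(y, x) \<in> arg_ord T f L"
    then have "x j = y j" if "j \<in> arity T f" for j
      using dcpo_antisym[OF dcpos[OF that]] that by (auto simp: arg_ord_def dest: antisymD)
    moreover have "x \<in> extensional (arity T f)" "y \<in> extensional (arity T f)"
      using xy by (auto simp: arg_ord_def arg_tuples_def PiE_def)
    ultimately show "x = y" by (metis extensionalityI)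
  qed
  ultimately have "s = ?u" using is_supremum_unique[OF _ s] by simp
  then show ?thesis using u[OF k] k by simp
qed

lemma map_args_cong:
  assumes "x \<in> arg_tuples T f L" "\<And>u. u \<in> Field L \<Longrightarrow> h u = h' u"
  shows "map_args T f h x = map_args T f h' x"
  unfolding map_args_def using assms
  by (intro restrict_ext) (auto simp: arg_tuples_def sort_ord_def PiE_iff split: option.splits)

lemma map_args_id:
  assumes "x \<in> arg_tuples T f L" "\<And>u. u \<in> Field L \<Longrightarrow> h u = u"
  shows "map_args T f h x = x"
proof (rule ext)
  fix k
  show "map_args T f h x k = x k"
    using assms unfolding map_args_def arg_tuples_def
    by (cases "k \<in> arity T f")
      (force simp: sort_ord_def PiE_iff extensional_def split: option.splits)+
qed

section \<open>Admissible tuples, sub o.b.d.algebras and closures\<close>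

locale obd_theory = order_universe small pr
  for small :: "'u set \<Rightarrow> bool" and pr :: "'u \<times> 'u \<Rightarrow> 'u" +
  fixes T :: "('f, 'i, 'u, 'v) dtheory" and \<Omega> :: "'f \<Rightarrow> 'u rel \<Rightarrow> ('i \<Rightarrow> 'u) set"
  assumes theory_T: "d_algebraic_theory small T"
    and obs: "order_bound_system small T \<Omega>"
begin

lemma slot_sort_Sigma0: "f \<in> Sigma0 T \<Longrightarrow> slot_sort T f k = None"
  using theory_T by (auto simp: d_algebraic_theory_def slot_sort_def)

lemma slot_sort_cases: 
  "f \<in> Sigma0 T \<union> Sigma1 T \<Longrightarrow> k \<in> arity T f \<Longrightarrow> slot_sort T f k \<in> insert None (Some ` params T)"
  using theory_T unfolding d_algebraic_theory_def slot_sort_def by auto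

lemma arg_tuples_Sigma0: "f \<in> Sigma0 T \<Longrightarrow> arg_tuples T f L = (\<Pi>\<^sub>E k\<in>arity T f. Field L)"
  by (simp add: arg_tuples_def slot_sort_Sigma0 sort_ord_def)

lemma map_args_Sigma0: "f \<in> Sigma0 T \<Longrightarrow> map_args T f h x = (\<lambda>k\<in>arity T f. h (x k))"
  by (auto simp: map_args_def slot_sort_Sigma0)

lemma dcpo_sort:
  assumes "dcpo L" "f \<in> Sigma0 T \<union> Sigma1 T" "k \<in> arity T f"
  shows "dcpo (sort_ord L (slot_sort T f k))"
  using slot_sort_cases[OF assms(2,3)] assms(1) theory_T
  by (auto simp: sort_ord_def d_algebraic_theory_def DCPO_def)

lemma admissible_subset: "L \<in> POS small \<Longrightarrow> admissible T \<Omega> f L \<subseteq> arg_tuples T f L"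
  using obs arg_tuples_Sigma0[of f L] by (auto simp: admissible_def order_bound_system_def)

text \<open>For \<open>Sigma0\<close> this is the functor action of \<open>\<Omega>\<close>;
  otherwise every tuple is admissible and it is enough that \<open>h\<close> respects the carriers,
  parameters being fixed. Phrasing both through \<open>map_args\<close> spares later proofs the
  distinction.\<close>

lemma map_args_admissible:
  assumes P: "P \<in> POS small" and Q: "Q \<in> POS small" and h: "order_preserving P Q h"
    and x: "x \<in> admissible T \<Omega> f P"
  shows "map_args T f h x \<in> admissible T \<Omega> f Q"
proof (cases "f \<in> Sigma0 T")
  case True
  then have "(\<lambda>x. \<lambda>k\<in>arity T f. h (x k)) ` \<Omega> f P \<subseteq> \<Omega> f Q"
    using obs P Q h by (auto simp: order_bound_system_def)
  then show ?thesis using True x by (auto simp: admissible_def map_args_Sigma0)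
next
  case False
  have "h u \<in> Field Q" if "u \<in> Field P" for u using h that by (auto simp: order_preserving_def)
  then show ?thesis
    using False x
    by (auto simp: admissible_def arg_tuples_def map_args_def PiE_iff sort_ord_def
        split: option.splits)
qed

text \<open>\<open>admissible\<close> tests membership in \<open>Sigma0\<close> first, so the
  uniform clause is faithful because the two operator sets are disjoint.\<close>

lemma sub_obd_algebra_iff:
  "sub_obd_algebra T \<Omega> L I S \<longleftrightarrow>
    subdcpo L S \<and> (\<forall>f\<in>Sigma0 T \<union> Sigma1 T. I f ` admissible T \<Omega> f (Restr L S) \<subseteq> S)"
proof -
  have "f \<notin> Sigma0 T" if "f \<in> Sigma1 T" for f
    using theory_T that by (auto simp: d_algebraic_theory_def)
  then show ?thesis by (simp add: sub_obd_algebra_def admissible_def ball_Un cong: ball_cong)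
qed

lemma POS_Restr:
  assumes "L \<in> POS small"
  shows "Restr L S \<in> POS small"
  using assms Partial_order_Restr mono_Field[of "Restr L S" L] small_subset
  by (auto simp: POS_def)

text \<open>The inclusion is order-preserving, so the functor acts on it. Its extensional form
  \<open>id_map\<close> moves no carrier entry of a tuple over \<open>S\<close>, whence the tuple
  itself is admissible in the larger poset.\<close>

lemma admissible_Restr_mono:
  assumes L: "L \<in> DCPO small" and SS': "S \<subseteq> S'" "S' \<subseteq> Field L"
  shows "admissible T \<Omega> f (Restr L S) \<subseteq> admissible T \<Omega> f (Restr L S')"
proof
  note POS = POS_Restr[OF DCPO_POS[OF L]]
  have F: "Field (Restr L S) = S" "Field (Restr L S') = S'"
    using Refl_Field_Restr2[OF dcpo_refl[OF DCPO_dcpo[OF L]]] SS' by auto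
  fix x assume x: "x \<in> admissible T \<Omega> f (Restr L S)"
  have "order_preserving (Restr L S) (Restr L S') (id_map (Restr L S))"
    using SS' F by (auto simp: order_preserving_def id_map_def)
  moreover have "map_args T f (id_map (Restr L S)) x = x"
    by (rule map_args_id[OF subsetD[OF admissible_subset[OF POS] x]]) (simp add: id_map_def)
  ultimately show "x \<in> admissible T \<Omega> f (Restr L S')"
    using map_args_admissible[OF POS POS _ x] by metis
qed

lemma d_algebraD:
  assumes "d_algebra small T L I"
  shows "L \<in> DCPO small"
    and "f \<in> Sigma0 T \<union> Sigma1 T \<Longrightarrow> scott_continuous_on (arg_tuples T f L) (arg_ord T f L) L (I f)"
    and "l \<in> laws T \<Longrightarrow> obeys T (arg_tuples T) L I l"
  using assms by (auto simp: d_algebra_def obd_algebra_def admissible_def)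

lemma d_algebra_closed:
  assumes "d_algebra small T L I" "f \<in> Sigma0 T \<union> Sigma1 T" "x \<in> arg_tuples T f L"
  shows "I f x \<in> Field L"
  using d_algebraD(2)[OF assms(1,2)] assms(3) by (auto simp: scott_continuous_on_def)

text \<open>Totality keeps all values in the carrier. The family whose intersection is the closure
  is thereby nonempty.\<close>

lemma sub_obd_algebra_Field:
  assumes L: "d_algebra small T L I"
  shows "sub_obd_algebra T \<Omega> L I (Field L)"
  unfolding sub_obd_algebra_iff Restr_Field_self
  using subdcpo_Field[of L] d_algebra_closed[OF L]
    admissible_subset[OF DCPO_POS[OF d_algebraD(1)[OF L]]]
  by blast

lemma sub_obd_algebra_Inter:
  assumes L: "L \<in> DCPO small" and "\<X> \<noteq> {}" and sub: "\<And>X. X \<in> \<X> \<Longrightarrow> sub_obd_algebra T \<Omega> L I X"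
  shows "sub_obd_algebra T \<Omega> L I (\<Inter>\<X>)"
  unfolding sub_obd_algebra_iff
proof (intro conjI ballI)
  show "subdcpo L (\<Inter>\<X>)"
    using assms sub_obd_algebra_iff by (intro subdcpo_Inter) auto
  fix f assume f: "f \<in> Sigma0 T \<union> Sigma1 T"
  show "I f ` admissible T \<Omega> f (Restr L (\<Inter>\<X>)) \<subseteq> \<Inter>\<X>"
  proof (rule Inter_greatest)
    fix X assume X: "X \<in> \<X>"
    have "admissible T \<Omega> f (Restr L (\<Inter>\<X>)) \<subseteq> admissible T \<Omega> f (Restr L X)"
      using X sub[OF X] by (intro admissible_Restr_mono[OF L]) (auto simp: sub_obd_algebra_iff subdcpo_def)
    then show "I f ` admissible T \<Omega> f (Restr L (\<Inter>\<X>)) \<subseteq> X"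
      using sub[OF X] f unfolding sub_obd_algebra_iff by blast
  qed
qed

lemma sub_obd_algebra_closure:
  assumes L: "d_algebra small T L I" and S: "S \<subseteq> Field L"
  shows "sub_obd_algebra T \<Omega> L I (obd_closure T \<Omega> L I S)"
  unfolding obd_closure_def
  using sub_obd_algebra_Field[OF L] S
  by (intro sub_obd_algebra_Inter[OF d_algebraD(1)[OF L]]) auto

lemma obd_closure_superset: "S \<subseteq> obd_closure T \<Omega> L I S"
  by (auto simp: obd_closure_def)

lemma obd_closure_least: "sub_obd_algebra T \<Omega> L I X \<Longrightarrow> S \<subseteq> X \<Longrightarrow> obd_closure T \<Omega> L I S \<subseteq> X"
  by (auto simp: obd_closure_def)

text \<open>The restriction of \<open>h\<close> is order-preserving from the preimage to
  \<open>S\<close> with their induced orders, so it carries admissible tuples of the one to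
  admissible tuples of the other, where \<open>J f\<close> stays in \<open>S\<close>. The morphism
  equation then places \<open>h (I f x)\<close> in \<open>S\<close>.\<close>

lemma sub_obd_algebra_preimage:
  assumes L: "d_algebra small T L I" and K: "d_algebra small T K J"
    and h: "d_morphism T L I K J h" and S: "sub_obd_algebra T \<Omega> K J S"
  shows "sub_obd_algebra T \<Omega> L I {x \<in> Field L. h x \<in> S}"
  unfolding sub_obd_algebra_iff
proof (intro conjI ballI)
  let ?X = "{x \<in> Field L. h x \<in> S}"
  have LD: "L \<in> DCPO small" and KD: "K \<in> DCPO small" using d_algebraD(1) L K by auto
  note dL = DCPO_dcpo[OF LD] and dK = DCPO_dcpo[OF KD]
  have hs: "h \<in> scott_maps L K" using h by (simp add: d_morphism_def obd_morphism_def)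
  have S': "subdcpo K S" using S sub_obd_algebra_iff by blast
  show X: "subdcpo L ?X" by (rule subdcpo_preimage[OF dL S' hs])
  have FX: "Field (Restr L ?X) = ?X" and FS: "Field (Restr K S) = S"
    using Refl_Field_Restr2[OF dcpo_refl[OF dL], of ?X] Refl_Field_Restr2[OF dcpo_refl[OF dK]]
      subdcpoD(1)[OF S'] by blast+
  have op: "order_preserving (Restr L ?X) (Restr K S) (restrict h ?X)"
    unfolding order_preserving_def FX FS using scott_maps_mono[OF dL hs] by auto
  fix f assume f: "f \<in> Sigma0 T \<union> Sigma1 T"
  show "I f ` admissible T \<Omega> f (Restr L ?X) \<subseteq> ?X"
  proof (intro image_subsetI)
    fix x assume x: "x \<in> admissible T \<Omega> f (Restr L ?X)"
    note POS = POS_Restr[OF DCPO_POS[OF LD]] POS_Restr[OF DCPO_POS[OF KD]]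
    have xX: "x \<in> arg_tuples T f (Restr L ?X)" using x admissible_subset[OF POS(1)] by blast
    \<comment> \<open>The morphism equation is available on tuples of \<open>L\<close>, so
      admissibility in the induced poset is first traded for that.\<close>
    have xL: "x \<in> arg_tuples T f L"
      using x admissible_Restr_mono[OF LD, of ?X "Field L" f] admissible_subset[OF DCPO_POS[OF LD]]
      unfolding Restr_Field_self by blast
    have "h (I f x) = J f (map_args T f h x)"
      using h f xL by (auto simp: d_morphism_def obd_morphism_def admissible_def)
    also have "map_args T f h x = map_args T f (restrict h ?X) x"
      by (rule map_args_cong[OF xX]) (simp add: FX)
    also have "J f \<dots> \<in> S"
      using map_args_admissible[OF POS op x] S f unfolding sub_obd_algebra_iff by blast
    finally show "I f x \<in> ?X" using d_algebra_closed[OF L f xL] by simp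
  qed
qed

text \<open>Minimality of the closure replaces an induction over the way its elements are generated
  from \<open>X\<close> by operations and directed suprema.\<close>

lemma morphism_closure:
  assumes "d_algebra small T L I" "d_algebra small T K J"
    and "d_morphism T L I K J h" "sub_obd_algebra T \<Omega> K J S"
    and "X \<subseteq> Field L" "h ` X \<subseteq> S"
  shows "h ` obd_closure T \<Omega> L I X \<subseteq> S"
  using obd_closure_least[OF sub_obd_algebra_preimage[OF assms(1-4)], of X] assms(5,6) by blast

section \<open>Operations, laws and morphisms induced on a sub o.b.d.algebra\<close>

lemma scott_continuous_on_sub:
  assumes L: "d_algebra small T L I" and S: "subdcpo L S" and f: "f \<in> Sigma0 T \<union> Sigma1 T"
    and X: "X \<subseteq> arg_tuples T f (Restr L S)" "I f ` X \<subseteq> S"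
  shows "scott_continuous_on X (arg_ord T f (Restr L S)) (Restr L S) (restrict (I f) X)"
proof -
  let ?K = "Restr L S"
  note dL = DCPO_dcpo[OF d_algebraD(1)[OF L]]
  note dK = dcpo_Restr[OF dL S]
  note SL = subdcpoD(1)[OF S]
  have FK: "Field ?K = S" using Refl_Field_Restr2[OF dcpo_refl[OF dL] SL] .
  have sub: "sort_ord ?K \<sigma> \<subseteq> sort_ord L \<sigma>" for \<sigma> by (cases \<sigma>) (auto simp: sort_ord_def)
  have tup: "arg_tuples T f ?K \<subseteq> arg_tuples T f L"
    using mono_Field[OF sub] unfolding arg_tuples_def by (intro PiE_mono)
  have ord: "arg_ord T f ?K \<subseteq> arg_ord T f L" using tup sub by (auto simp: arg_ord_def)
  \<comment> \<open>A carrier slot uses the agreement of suprema in a subdcpo; a parameter slot has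
    the same order on both sides. Suprema of tuples thus lift to \<open>L\<close>, where continuity
    of the total operation applies.\<close>
  have sort_sup: "is_supremum (sort_ord L \<sigma>) D s"
    if "directed_in (sort_ord ?K \<sigma>) D" "is_supremum (sort_ord ?K \<sigma>) D s" for \<sigma> D s
    using that is_supremum_Restr[OF dL S] by (cases \<sigma>) (auto simp: sort_ord_def)
  have refl: "(x, x) \<in> arg_ord T f ?K" if "x \<in> arg_tuples T f ?K" for x
    using that dcpo_reflD[OF dcpo_sort[OF dK f]] by (auto simp: arg_ord_def arg_tuples_def)
  have "is_supremum ?K (restrict (I f) X ` D) (restrict (I f) X s)"
    if D: "directed_in (arg_ord T f ?K) D" "D \<subseteq> X"
      and s: "is_supremum (arg_ord T f ?K) D s" "s \<in> X" for D s
  proof -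
    have DL: "directed_in (arg_ord T f L) D" using directed_in_mono[OF D(1) ord] .
    have "is_supremum (arg_ord T f L) D s"
    proof (rule is_supremum_arg_ordI)
      show "s \<in> arg_tuples T f L" "D \<subseteq> arg_tuples T f L" using s D X tup by auto
      show "D \<noteq> {}" using D by (simp add: directed_in_def)
      fix k assume k: "k \<in> arity T f"
      show "is_supremum (sort_ord L (slot_sort T f k)) ((\<lambda>x. x k) ` D) (s k)"
        using k by (intro sort_sup is_supremum_arg_ordD[OF dcpo_sort[OF dK f] D(1) s(1)]
          directed_in_image[OF D(1)]) (auto simp: arg_ord_def)
    qed
    then have "is_supremum L (I f ` D) (I f s)"
      using d_algebraD(2)[OF L f] DL D s X tup unfolding scott_continuous_on_def by blast
    then have "is_supremum ?K (I f ` D) (I f s)"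
      using X D s by (intro is_supremum_RestrI[OF dL SL]) auto
    moreover have "restrict (I f) X ` D = I f ` D" using D by (intro image_cong) auto
    ultimately show ?thesis using s by simp
  qed
  moreover have "X \<subseteq> Field (arg_ord T f ?K)" using X refl by (auto intro: FieldI1)
  moreover have "restrict (I f) X \<in> X \<rightarrow>\<^sub>E Field ?K" using X(2) FK by (auto simp: image_subset_iff)
  ultimately show ?thesis by (simp add: scott_continuous_on_def)
qed

text \<open>Definedness only has to pass from the partial algebra to the total one: admissible
  tuples are tuples of \<open>L\<close>, and on them \<open>J\<close> and \<open>I\<close> agree.
  Hence laws are inherited. The last conjunct keeps values in \<open>S\<close>, which inequational
  laws need.\<close>

lemma eval_sub:
  assumes L: "L \<in> DCPO small" and S: "sub_obd_algebra T \<Omega> L I S"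
    and J: "\<And>f. f \<in> Sigma0 T \<union> Sigma1 T \<Longrightarrow> J f = restrict (I f) (admissible T \<Omega> f (Restr L S))"
  shows "has_sort T t \<sigma> \<Longrightarrow> term_defined T \<Omega> (Restr L S) J \<rho> t \<Longrightarrow>
    term_defined T (arg_tuples T) L I \<rho> t \<and> eval_term T J \<rho> t = eval_term T I \<rho> t
    \<and> eval_term T J \<rho> t \<in> Field (sort_ord (Restr L S) \<sigma>)"
proof (induction t arbitrary: \<sigma>)
  case (Var \<tau> v)
  have "Field (sort_ord (Restr L S) \<tau>) \<subseteq> Field (sort_ord L \<tau>)"
    by (intro mono_Field) (cases \<tau>; auto simp: sort_ord_def)
  then show ?case using Var by auto
next
  case (Const D c)
  then show ?case by (simp add: sort_ord_def)
next
  case (Op f ts)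
  let ?K = "Restr L S"
  have SL: "S \<subseteq> Field L" and sub: "\<And>f. f \<in> Sigma0 T \<union> Sigma1 T \<Longrightarrow> I f ` admissible T \<Omega> f ?K \<subseteq> S"
    using S sub_obd_algebra_iff subdcpoD(1) by blast+
  have FK: "Field ?K = S" using Refl_Field_Restr2[OF dcpo_refl[OF DCPO_dcpo[OF L]] SL] .
  have f: "f \<in> Sigma0 T \<union> Sigma1 T" and \<sigma>: "\<sigma> = None" using Op.prems(1) by auto
  have IH: "term_defined T (arg_tuples T) L I \<rho> (ts k) \<and>
      eval_term T J \<rho> (ts k) = eval_term T I \<rho> (ts k)" if "k \<in> arity T f" for k
    using Op.IH[OF rangeI, of k "slot_sort T f k"] Op.prems that by auto
  let ?x = "\<lambda>k\<in>arity T f. eval_term T J \<rho> (ts k)"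
  have x: "?x = (\<lambda>k\<in>arity T f. eval_term T I \<rho> (ts k))" using IH by (intro restrict_ext) auto
  have adm: "?x \<in> admissible T \<Omega> f ?K" using Op.prems(2) by simp
  have "?x \<in> arg_tuples T f L"
    using adm admissible_Restr_mono[OF L SL, of f] admissible_subset[OF DCPO_POS[OF L]]
    unfolding Restr_Field_self by blast
  moreover have "J f ?x = I f ?x" using adm J[OF f] by simp
  moreover have "I f ?x \<in> S" using sub[OF f] adm by blast
  ultimately show ?case using IH x \<sigma> FK by (auto simp: admissible_def sort_ord_def)
qed

lemma obd_algebra_sub:
  assumes L: "d_algebra small T L I" and S: "sub_obd_algebra T \<Omega> L I S"
    and J: "\<And>f. f \<in> Sigma0 T \<union> Sigma1 T \<Longrightarrow> J f = restrict (I f) (admissible T \<Omega> f (Restr L S))"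
  shows "obd_algebra small T \<Omega> (Restr L S) J"
  unfolding obd_algebra_def
proof (intro conjI ballI)
  note LD = d_algebraD(1)[OF L]
  have S': "subdcpo L S" using S sub_obd_algebra_iff by blast
  show KD: "Restr L S \<in> DCPO small" by (rule DCPO_Restr[OF LD S'])
  show "scott_continuous_on (admissible T \<Omega> f (Restr L S)) (arg_ord T f (Restr L S)) (Restr L S) (J f)"
    if f: "f \<in> Sigma0 T \<union> Sigma1 T" for f
    unfolding J[OF f]
    using S f admissible_subset[OF DCPO_POS[OF KD]] unfolding sub_obd_algebra_iff
    by (intro scott_continuous_on_sub[OF L S' f]) auto
  fix l assume l: "l \<in> laws T"
  then have wf: "wf_law T l" using theory_T by (auto simp: d_algebraic_theory_def)
  have FK: "Field (Restr L S) = S"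
    using Refl_Field_Restr2[OF dcpo_refl[OF DCPO_dcpo[OF LD]] subdcpoD(1)[OF S']] .
  note ev = eval_sub[OF LD S J, where \<sigma> = None]
  have o: "obeys T (arg_tuples T) L I l" by (rule d_algebraD(3)[OF L l])
  show "obeys T \<Omega> (Restr L S) J l"
  proof (cases l)
    case (Equation a b)
    then show ?thesis using wf o ev[of a] ev[of b] by simp
  next
    case (Inequation a b)
    \<comment> \<open>An inequality in \<open>Restr L S\<close> also demands that both values lie in
      \<open>S\<close>; this is the membership part of \<open>eval_sub\<close>.\<close>
    show ?thesis
      unfolding Inequation obeys.simps
    proof (intro allI impI, elim conjE)
      fix \<rho> assume "term_defined T \<Omega> (Restr L S) J \<rho> a" "term_defined T \<Omega> (Restr L S) J \<rho> b"
      then show "(eval_term T J \<rho> a, eval_term T J \<rho> b) \<in> Restr L S"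
        using wf o ev[of a \<rho>] ev[of b \<rho>] FK Inequation by (auto simp: sort_ord_def)
    qed
  qed
qed

text \<open>\<open>hs\<close> serves twice: as the typing of the restricted map and, through
  monotonicity, to make the image tuple admissible in \<open>Restr K S'\<close>. Only then does
  \<open>J'\<close> return the value of \<open>J\<close> rather than
  \<open>undefined\<close>.\<close>

lemma obd_morphism_sub:
  assumes L: "L \<in> DCPO small" and S: "sub_obd_algebra T \<Omega> L I S"
    and K: "K \<in> DCPO small" and S': "sub_obd_algebra T \<Omega> K J S'"
    and I': "\<And>f. f \<in> Sigma0 T \<union> Sigma1 T \<Longrightarrow> I' f = restrict (I f) (admissible T \<Omega> f (Restr L S))"
    and J': "\<And>f. f \<in> Sigma0 T \<union> Sigma1 T \<Longrightarrow> J' f = restrict (J f) (admissible T \<Omega> f (Restr K S'))"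
    and h: "d_morphism T L I K J h" and hs: "restrict h S \<in> scott_maps (Restr L S) (Restr K S')"
  shows "obd_morphism T \<Omega> (Restr L S) I' (Restr K S') J' (restrict h S)"
  unfolding obd_morphism_def
proof (intro conjI ballI hs)
  have SL: "subdcpo L S" and SK: "subdcpo K S'" using S S' sub_obd_algebra_iff by auto
  fix f x assume f: "f \<in> Sigma0 T \<union> Sigma1 T" and x: "x \<in> admissible T \<Omega> f (Restr L S)"
  note KL = DCPO_Restr[OF L SL] and KK = DCPO_Restr[OF K SK]
  have FK: "Field (Restr L S) = S"
    using Refl_Field_Restr2[OF dcpo_refl[OF DCPO_dcpo[OF L]] subdcpoD(1)[OF SL]] .
  have xS: "x \<in> arg_tuples T f (Restr L S)" using x admissible_subset[OF DCPO_POS[OF KL]] by blast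
  have xL: "x \<in> arg_tuples T f L"
    using x admissible_Restr_mono[OF L subdcpoD(1)[OF SL] order_refl, of f]
      admissible_subset[OF DCPO_POS[OF L]]
    unfolding Restr_Field_self by blast
  have "map_args T f (restrict h S) x \<in> admissible T \<Omega> f (Restr K S')"
    using map_args_admissible[OF DCPO_POS[OF KL] DCPO_POS[OF KK]
        scott_maps_order_preserving[OF DCPO_dcpo[OF KL] hs] x] .
  moreover have m: "map_args T f (restrict h S) x = map_args T f h x"
    by (rule map_args_cong[OF xS]) (simp add: FK)
  ultimately have "J' f (map_args T f (restrict h S) x) = J f (map_args T f h x)"
    using J'[OF f] by simp
  also have "\<dots> = h (I f x)"
    using h f xL by (auto simp: d_morphism_def obd_morphism_def admissible_def)
  also have "\<dots> = restrict h S (I' f x)"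
    using I'[OF f] x S f unfolding sub_obd_algebra_iff by auto
  finally show "restrict h S (I' f x) = J' f (map_args T f (restrict h S) x)" by (rule sym)
qed

end

section \<open>Kleisli triples and strength\<close>

locale kleisli = order_universe small pr
  for small :: "'u set \<Rightarrow> bool" and pr :: "'u \<times> 'u \<Rightarrow> 'u" +
  fixes P :: "'u rel \<Rightarrow> 'u rel" and \<eta> :: "'u rel \<Rightarrow> 'u \<Rightarrow> 'u"
    and dag :: "'u rel \<Rightarrow> 'u rel \<Rightarrow> ('u \<Rightarrow> 'u) \<Rightarrow> 'u \<Rightarrow> 'u"
  assumes kleisli: "kleisli_triple small P \<eta> dag"
begin

lemma P_DCPO: "A \<in> DCPO small \<Longrightarrow> P A \<in> DCPO small"
  and eta_scott: "A \<in> DCPO small \<Longrightarrow> \<eta> A \<in> scott_maps A (P A)"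
  and dag_scott: "A \<in> DCPO small \<Longrightarrow> B \<in> DCPO small \<Longrightarrow> f \<in> scott_maps A (P B) \<Longrightarrow>
    dag A B f \<in> scott_maps (P A) (P B)"
  and dag_eta: "A \<in> DCPO small \<Longrightarrow> dag A A (\<eta> A) = (\<lambda>u\<in>Field (P A). u)"
  and dag_compose_eta: "A \<in> DCPO small \<Longrightarrow> B \<in> DCPO small \<Longrightarrow> f \<in> scott_maps A (P B) \<Longrightarrow>
    compose (Field A) (dag A B f) (\<eta> A) = f"
  and dag_compose_dag: "A \<in> DCPO small \<Longrightarrow> B \<in> DCPO small \<Longrightarrow> C \<in> DCPO small \<Longrightarrow>
    g \<in> scott_maps A (P B) \<Longrightarrow> f \<in> scott_maps B (P C) \<Longrightarrow>
    compose (Field (P A)) (dag B C f) (dag A B g) = dag A C (compose (Field A) (dag B C f) g)"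
  using kleisli by (simp_all add: kleisli_triple_def)

lemma dag_unit:
  assumes "A \<in> DCPO small" "B \<in> DCPO small" "f \<in> scott_maps A (P B)" "a \<in> Field A"
  shows "dag A B f (\<eta> A a) = f a"
  using fun_cong[OF dag_compose_eta[OF assms(1-3)], of a] assms(4) by (simp add: compose_def)

lemma dag_dag:
  assumes "A \<in> DCPO small" "B \<in> DCPO small" "C \<in> DCPO small"
    and "g \<in> scott_maps A (P B)" "f \<in> scott_maps B (P C)" "u \<in> Field (P A)"
  shows "dag B C f (dag A B g u) = dag A C (compose (Field A) (dag B C f) g) u"
  using fun_cong[OF dag_compose_dag[OF assms(1-5)], of u] assms(6) by (simp add: compose_def)

lemma eta_compose_scott:
  assumes "A \<in> DCPO small" "B \<in> DCPO small" "h \<in> scott_maps A B"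
  shows "compose (Field A) (\<eta> B) h \<in> scott_maps A (P B)"
  using assms scott_maps_compose[OF DCPO_dcpo eta_scott] scott_maps_compose[OF DCPO_dcpo _ eta_scott]
  by blast

lemma kl_map_scott:
  assumes "A \<in> DCPO small" "B \<in> DCPO small" "h \<in> scott_maps A B"
  shows "kl_map \<eta> dag A B h \<in> scott_maps (P A) (P B)"
  unfolding kl_map_def using dag_scott[OF assms(1,2) eta_compose_scott[OF assms]] .

lemma kl_map_eta:
  assumes "A \<in> DCPO small" "B \<in> DCPO small" "h \<in> scott_maps A B" "a \<in> Field A"
  shows "kl_map \<eta> dag A B h (\<eta> A a) = \<eta> B (h a)"
  unfolding kl_map_def dag_unit[OF assms(1,2) eta_compose_scott[OF assms(1-3)] assms(4)]
  using assms(4) by (simp add: compose_def)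

lemma kl_map_id:
  assumes "A \<in> DCPO small" "u \<in> Field (P A)"
  shows "kl_map \<eta> dag A A (id_map A) u = u"
proof -
  have "compose (Field A) (\<eta> A) (id_map A) = restrict (\<eta> A) (Field A)"
    unfolding compose_def by (intro restrict_ext) (simp add: id_map_def)
  also have "\<dots> = \<eta> A" 
    using scott_maps_extensional[OF eta_scott[OF assms(1)]] by (rule extensional_restrict)
  finally show ?thesis using assms by (simp add: kl_map_def dag_eta)
qed

text \<open>Extending \<open>f\<close> and precomposing with the unit gives back \<open>f\<close>,
  so an extension absorbs a preceding functor action. Taking for \<open>f\<close> the unit after a
  map yields functoriality; read backwards, the rule splits off a multiplication.\<close>

lemma dag_kl_map:
  assumes A: "A \<in> DCPO small" and B: "B \<in> DCPO small" and C: "C \<in> DCPO small"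
    and h: "h \<in> scott_maps A B" and f: "f \<in> scott_maps B (P C)" and u: "u \<in> Field (P A)"
  shows "dag B C f (kl_map \<eta> dag A B h u) = dag A C (compose (Field A) f h) u"
proof -
  have "compose (Field A) (dag B C f) (compose (Field A) (\<eta> B) h) = compose (Field A) f h"
    unfolding compose_def
    using dag_unit[OF B C f scott_maps_Field[OF h]] by (intro restrict_ext) simp
  then show ?thesis
    unfolding kl_map_def dag_dag[OF A B C eta_compose_scott[OF A B h] f u] by simp
qed

lemma kl_map_kl_map:
  assumes A: "A \<in> DCPO small" and B: "B \<in> DCPO small" and C: "C \<in> DCPO small"
    and h: "h \<in> scott_maps A B" and g: "g \<in> scott_maps B C" and u: "u \<in> Field (P A)"
  shows "kl_map \<eta> dag B C g (kl_map \<eta> dag A B h u) = kl_map \<eta> dag A C (compose (Field A) g h) u"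
proof -
  have "compose (Field A) (compose (Field B) (\<eta> C) g) h
      = compose (Field A) (\<eta> C) (compose (Field A) g h)"
    unfolding compose_def using scott_maps_Field[OF h] by (intro restrict_ext) simp
  then show ?thesis
    using dag_kl_map[OF A B C h eta_compose_scott[OF B C g] u] by (simp add: kl_map_def)
qed

text \<open>
  DCPO is well-pointed: naturality along the point a of A reduces the strength to its component
  at the one-point dcpo, which the unit law determines.
\<close>

lemma is_strength_apply:
  assumes t: "is_strength small pr P \<eta> dag t" and A: "A \<in> DCPO small" and B: "B \<in> DCPO small"
    and a: "a \<in> Field A" and u: "u \<in> Field (P B)"
  shows "t A B (pr (a, u)) = kl_map \<eta> dag B (prod_dcpo pr A B) (pair_with a B) u"
proof -
  \<comment> \<open>The one-point dcpo is built on \<open>a\<close> itself, so that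
    \<open>?f\<close> is the point of \<open>A\<close> at \<open>a\<close> and leaves the first
    component of \<open>pr (a, u)\<close> unchanged.\<close>
  let ?U = "{(a, a)}"
  let ?f = "\<lambda>x\<in>Field ?U. a"
  note O = DCPO_singleton[of a]
  note dA = DCPO_dcpo[OF A] and dB = DCPO_dcpo[OF B] and dO = DCPO_dcpo[OF O]
  note dPB = DCPO_dcpo[OF P_DCPO[OF B]]
  have F1: "Field ?U = {a}" by (auto simp: Field_def)
  have FB: "Field (prod_dcpo pr ?U B) = pr ` ({a} \<times> Field B)"
    using Field_prod_dcpo[OF dcpo_refl[OF dO] dcpo_refl[OF dB]] F1 by simp
  have FPB: "Field (prod_dcpo pr ?U (P B)) = pr ` ({a} \<times> Field (P B))"
    using Field_prod_dcpo[OF dcpo_refl[OF dO] dcpo_refl[OF dPB]] F1 by simp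
  have au: "pr (a, u) \<in> Field (prod_dcpo pr ?U (P B))" using FPB u by simp
  have f: "?f \<in> scott_maps ?U A" by (rule const_scott[OF dA a])
  have t1: "t ?U B \<in> scott_maps (prod_dcpo pr ?U (P B)) (P (prod_dcpo pr ?U B))"
    using t O B by (simp add: is_strength_def)
  define w where "w = t ?U B (pr (a, u))"
  have w: "w \<in> Field (P (prod_dcpo pr ?U B))"
    unfolding w_def by (rule scott_maps_Field[OF t1 au])
  have "compose (Field (prod_dcpo pr ?U (P B)))
      (kl_map \<eta> dag (prod_dcpo pr ?U B) (prod_dcpo pr A B) (prod_map pr ?U B ?f (id_map B))) (t ?U B)
    = compose (Field (prod_dcpo pr ?U (P B)))
      (t A B) (prod_map pr ?U (P B) ?f (kl_map \<eta> dag B B (id_map B)))"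
    using t O A B f id_map_scott[of B] by (simp add: is_strength_def)
  from fun_cong[OF this, of "pr (a, u)"] au
  have nat: "t A B (pr (a, u))
      = kl_map \<eta> dag (prod_dcpo pr ?U B) (prod_dcpo pr A B) (prod_map pr ?U B ?f (id_map B)) w"
    using F1 by (simp add: compose_def prod_map_def kl_map_id[OF B u] w_def)
  have "compose (Field (prod_dcpo pr ?U (P B)))
      (kl_map \<eta> dag (prod_dcpo pr ?U B) B (prod_snd pr ?U B)) (t ?U B) = prod_snd pr ?U (P B)"
    using t B by (simp add: is_strength_def)
  from fun_cong[OF this, of "pr (a, u)"] au
  have unit: "u = kl_map \<eta> dag (prod_dcpo pr ?U B) B (prod_snd pr ?U B) w"
    by (simp add: compose_def prod_snd_def w_def)
  \<comment> \<open>The unit law has expressed \<open>u\<close> as the image of \<open>w\<close>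
    under the second projection. Functoriality merges both actions on \<open>w\<close>, and over the
    one-point dcpo inserting \<open>a\<close> after projecting is the product map from
    naturality.\<close>
  have "kl_map \<eta> dag B (prod_dcpo pr A B) (pair_with a B) u
      = kl_map \<eta> dag (prod_dcpo pr ?U B) (prod_dcpo pr A B)
          (compose (Field (prod_dcpo pr ?U B)) (pair_with a B) (prod_snd pr ?U B)) w"
    by (subst unit, rule kl_map_kl_map)
      (use O A B w dA dB dO a in \<open>auto intro: DCPO_prod_dcpo prod_snd_scott pair_with_scott\<close>)
  also have "compose (Field (prod_dcpo pr ?U B)) (pair_with a B) (prod_snd pr ?U B)
      = prod_map pr ?U B ?f (id_map B)"
    unfolding compose_def prod_map_def
    by (intro restrict_ext) (auto simp: FB F1 prod_snd_def pair_with_def id_map_def)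
  finally show ?thesis using nat by simp
qed

text \<open>Evaluated at a pair, each law becomes by the Kleisli laws a comparison of functor
  actions or extensions, and these agree because the maps they are applied to do. Continuity
  \<open>ts\<close> is asked for separately, as the formula controls \<open>t A B\<close> only for
  fixed \<open>a\<close>.\<close>

lemma is_strengthI:
  assumes ts: "\<And>A B. A \<in> DCPO small \<Longrightarrow> B \<in> DCPO small \<Longrightarrow>
      t A B \<in> scott_maps (prod_dcpo pr A (P B)) (P (prod_dcpo pr A B))"
    and t: "\<And>A B a u. A \<in> DCPO small \<Longrightarrow> B \<in> DCPO small \<Longrightarrow> a \<in> Field A \<Longrightarrow> u \<in> Field (P B) \<Longrightarrow>
      t A B (pr (a, u)) = kl_map \<eta> dag B (prod_dcpo pr A B) (pair_with a B) u"
  shows "is_strength small pr P \<eta> dag t"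
  unfolding is_strength_def
proof (intro conjI ballI allI)
  have F: "Field (prod_dcpo pr A B) = pr ` (Field A \<times> Field B)"
    if "A \<in> DCPO small" "B \<in> DCPO small" for A B
    using Field_prod_dcpo that by (simp add: DCPO_dcpo dcpo_refl)
  have pw: "pair_with a B \<in> scott_maps B (prod_dcpo pr A B)"
    if "A \<in> DCPO small" "B \<in> DCPO small" "a \<in> Field A" for A B a
    using that by (simp add: pair_with_scott DCPO_dcpo)
  have prod_ext: "compose (Field (prod_dcpo pr A B)) f g = compose (Field (prod_dcpo pr A B)) f' g'"
    if "A \<in> DCPO small" "B \<in> DCPO small"
      and "\<And>a b. a \<in> Field A \<Longrightarrow> b \<in> Field B \<Longrightarrow> f (g (pr (a, b))) = f' (g' (pr (a, b)))"
    for A B and f g f' g' :: "'u \<Rightarrow> 'u"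
    unfolding compose_def using that by (intro restrict_ext) (auto simp: F)
  fix A assume A: "A \<in> DCPO small"
  note PA = P_DCPO[OF A]
  {
    fix c :: 'u
    let ?U = "{(c, c)}"
    note O = DCPO_singleton[of c]
    have FO: "Field ?U = {c}" by (auto simp: Field_def)
    \<comment> \<open>By functoriality this reduces to the second projection after
      \<open>pair_with x A\<close> being the identity.\<close>
    have "kl_map \<eta> dag (prod_dcpo pr ?U A) A (prod_snd pr ?U A) (t ?U A (pr (x, u)))
        = prod_snd pr ?U (P A) (pr (x, u))" if x: "x \<in> Field ?U" and u: "u \<in> Field (P A)" for x u
    proof -
      have "kl_map \<eta> dag (prod_dcpo pr ?U A) A (prod_snd pr ?U A) (t ?U A (pr (x, u)))
          = kl_map \<eta> dag A A (compose (Field A) (prod_snd pr ?U A) (pair_with x A)) u"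
        unfolding t[OF O A x u]
        by (rule kl_map_kl_map[OF A DCPO_prod_dcpo[OF O A] A pw[OF O A x] _ u])
          (simp add: prod_snd_scott DCPO_dcpo A O)
      also have "compose (Field A) (prod_snd pr ?U A) (pair_with x A) = id_map A"
        unfolding compose_def id_map_def
        using x by (intro restrict_ext) (simp add: pair_with_def prod_snd_def F[OF O A])
      also have "kl_map \<eta> dag A A (id_map A) u = u" by (rule kl_map_id[OF A u])
      also have "u = prod_snd pr ?U (P A) (pr (x, u))"
        using x u by (simp add: prod_snd_def F[OF O PA])
      finally show ?thesis .
    qed
    then show "compose (Field (prod_dcpo pr ?U (P A)))
        (kl_map \<eta> dag (prod_dcpo pr ?U A) A (prod_snd pr ?U A)) (t ?U A) = prod_snd pr ?U (P A)"
      unfolding compose_def prod_snd_def[of pr ?U "P A"]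
      by (intro restrict_ext) (auto simp: F[OF O PA] prod_snd_def[of pr ?U "P A"])
  }
  fix B assume B: "B \<in> DCPO small"
  note PB = P_DCPO[OF B]
  note AB = DCPO_prod_dcpo[OF A B]
  note PAB = P_DCPO[OF AB]
  show "t A B \<in> scott_maps (prod_dcpo pr A (P B)) (P (prod_dcpo pr A B))" by (rule ts[OF A B])
  \<comment> \<open>The right-hand side of the law for \<open>\<eta>\<close> is no composite;
    writing it as one with the identity function lets \<open>prod_ext\<close> apply.\<close>
  have eta_AB: "compose (Field (prod_dcpo pr A B)) (\<eta> (prod_dcpo pr A B)) (\<lambda>z. z)
      = \<eta> (prod_dcpo pr A B)"
    using scott_maps_extensional[OF eta_scott[OF AB]] by (simp add: compose_def extensional_restrict)
  have "compose (Field (prod_dcpo pr A B)) (t A B) (prod_map pr A B (id_map A) (\<eta> B))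
      = compose (Field (prod_dcpo pr A B)) (\<eta> (prod_dcpo pr A B)) (\<lambda>z. z)"
  proof (rule prod_ext[OF A B])
    fix a b assume a: "a \<in> Field A" and b: "b \<in> Field B"
    have "prod_map pr A B (id_map A) (\<eta> B) (pr (a, b)) = pr (a, \<eta> B b)"
      using a b by (simp add: prod_map_def id_map_def F[OF A B])
    then show "t A B (prod_map pr A B (id_map A) (\<eta> B) (pr (a, b)))
        = \<eta> (prod_dcpo pr A B) (pr (a, b))"
      using t[OF A B a scott_maps_Field[OF eta_scott[OF B] b]] kl_map_eta[OF B AB pw[OF A B a] b] a b
      by (simp add: pair_with_def)
  qed
  then show "compose (Field (prod_dcpo pr A B)) (t A B) (prod_map pr A B (id_map A) (\<eta> B))
      = \<eta> (prod_dcpo pr A B)"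
    unfolding eta_AB .
  show "compose (Field (prod_dcpo pr A (P (P B))))
      (t A B) (prod_map pr A (P (P B)) (id_map A) (kl_mult P dag B))
    = compose (Field (prod_dcpo pr A (P (P B))))
        (kl_mult P dag (prod_dcpo pr A B))
        (compose (Field (prod_dcpo pr A (P (P B))))
           (kl_map \<eta> dag (prod_dcpo pr A (P B)) (P (prod_dcpo pr A B)) (t A B))
           (t A (P B)))"
  proof (rule prod_ext[OF A P_DCPO[OF PB]])
    fix a u assume a: "a \<in> Field A" and u: "u \<in> Field (P (P B))"
    let ?AB = "prod_dcpo pr A B" and ?APB = "prod_dcpo pr A (P B)"
    note APB = DCPO_prod_dcpo[OF A PB]
    have m: "kl_mult P dag B u \<in> Field (P B)"
      unfolding kl_mult_def using scott_maps_Field[OF dag_scott[OF PB B id_map_scott] u] .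
    have z: "pr (a, u) \<in> Field (prod_dcpo pr A (P (P B)))" using a u by (simp add: F[OF A P_DCPO[OF PB]])
    have "t A B (prod_map pr A (P (P B)) (id_map A) (kl_mult P dag B) (pr (a, u)))
        = kl_map \<eta> dag B ?AB (pair_with a B) (kl_mult P dag B u)"
      using t[OF A B a m] a z by (simp add: prod_map_def id_map_def)
    also have "\<dots> = dag (P B) ?AB
        (compose (Field (P B)) (kl_map \<eta> dag B ?AB (pair_with a B)) (id_map (P B))) u"
      unfolding kl_mult_def kl_map_def
      by (rule dag_dag[OF PB B AB id_map_scott eta_compose_scott[OF B AB pw[OF A B a]] u])
    \<comment> \<open>\<open>kl_mult\<close> is the extension of an identity map, so the identity on
      \<open>P ?AB\<close> is inserted here; \<open>dag_kl_map\<close> read backwards then splits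
      off the multiplication. The values lie in \<open>P ?AB\<close>, where \<open>id_map\<close> is
      not \<open>undefined\<close>.\<close>
    also have "compose (Field (P B)) (kl_map \<eta> dag B ?AB (pair_with a B)) (id_map (P B))
        = compose (Field (P B)) (id_map (P ?AB)) (compose (Field (P B)) (t A B) (pair_with a (P B)))"
      unfolding compose_def
    proof (rule restrict_ext)
      fix v assume v: "v \<in> Field (P B)"
      have "kl_map \<eta> dag B ?AB (pair_with a B) v \<in> Field (P ?AB)"
        by (rule scott_maps_Field[OF kl_map_scott[OF B AB pw[OF A B a]] v])
      then show "kl_map \<eta> dag B ?AB (pair_with a B) (id_map (P B) v)
          = id_map (P ?AB) ((\<lambda>x\<in>Field (P B). t A B (pair_with a (P B) x)) v)"
        using v t[OF A B a v] by (simp add: id_map_def pair_with_def)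
    qed
    also have "dag (P B) ?AB \<dots> u = kl_mult P dag ?AB
        (kl_map \<eta> dag (P B) (P ?AB) (compose (Field (P B)) (t A B) (pair_with a (P B))) u)"
      unfolding kl_mult_def
      by (rule dag_kl_map[OF PB PAB AB _ id_map_scott u, symmetric])
        (rule scott_maps_compose[OF DCPO_dcpo[OF PB] pw[OF A PB a] ts[OF A B]])
    also have "kl_map \<eta> dag (P B) (P ?AB) (compose (Field (P B)) (t A B) (pair_with a (P B))) u
        = kl_map \<eta> dag ?APB (P ?AB) (t A B) (t A (P B) (pr (a, u)))"
      unfolding t[OF A PB a u]
      by (rule kl_map_kl_map[OF PB APB PAB pw[OF A PB a] ts[OF A B] u, symmetric])
    finally show "t A B (prod_map pr A (P (P B)) (id_map A) (kl_mult P dag B) (pr (a, u)))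
      = kl_mult P dag ?AB (compose (Field (prod_dcpo pr A (P (P B))))
         (kl_map \<eta> dag ?APB (P ?AB) (t A B)) (t A (P B)) (pr (a, u)))"
      using z by (simp add: compose_def)
  qed
  fix C assume C: "C \<in> DCPO small"
  note PC = P_DCPO[OF C]
  let ?AB = "prod_dcpo pr A B" and ?BC = "prod_dcpo pr B C"
  note BC = DCPO_prod_dcpo[OF B C]
  note AB_C = DCPO_prod_dcpo[OF AB C] and A_BC = DCPO_prod_dcpo[OF A BC]
  show "compose (Field (prod_dcpo pr ?AB (P C)))
      (kl_map \<eta> dag (prod_dcpo pr ?AB C) (prod_dcpo pr A ?BC) (prod_assoc pr A B C)) (t ?AB C)
    = compose (Field (prod_dcpo pr ?AB (P C))) (t A ?BC)
        (compose (Field (prod_dcpo pr ?AB (P C)))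
           (prod_map pr A (prod_dcpo pr B (P C)) (id_map A) (t B C)) (prod_assoc pr A B (P C)))"
  proof (rule prod_ext[OF AB PC])
    fix y u assume y: "y \<in> Field ?AB" and u: "u \<in> Field (P C)"
    then obtain a b where ab: "y = pr (a, b)" "a \<in> Field A" "b \<in> Field B" by (auto simp: F[OF A B])
    have z: "pr (y, u) \<in> Field (prod_dcpo pr ?AB (P C))" using y u by (simp add: F[OF AB PC])
    have v: "t B C (pr (b, u)) \<in> Field (P ?BC)"
      using ab u by (intro scott_maps_Field[OF ts[OF B C]]) (simp add: F[OF B PC])
    have "kl_map \<eta> dag (prod_dcpo pr ?AB C) (prod_dcpo pr A ?BC) (prod_assoc pr A B C) (t ?AB C (pr (y, u)))
      = kl_map \<eta> dag C (prod_dcpo pr A ?BC) (compose (Field C) (prod_assoc pr A B C) (pair_with y C)) u"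
      unfolding t[OF AB C y u]
      using kl_map_kl_map[OF C AB_C A_BC pw[OF AB C y] _ u] prod_assoc_scott A B C DCPO_dcpo by blast
    \<comment> \<open>Inserting the pair of \<open>a\<close> and \<open>b\<close> and then
      reassociating is the same as inserting \<open>b\<close> and then \<open>a\<close>, which is
      how the nested strengths act.\<close>
    also have "compose (Field C) (prod_assoc pr A B C) (pair_with y C)
        = compose (Field C) (pair_with a ?BC) (pair_with b C)"
      unfolding compose_def
      using y ab by (intro restrict_ext)
        (simp add: prod_assoc_def pair_with_def F[OF AB C] F[OF B C] F[OF A B])
    also have "kl_map \<eta> dag C (prod_dcpo pr A ?BC) \<dots> u = t A ?BC (pr (a, t B C (pr (b, u))))"
      unfolding t[OF A BC ab(2) v] 
      unfolding t[OF B C ab(3) u]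
      by (rule kl_map_kl_map[OF C BC A_BC pw[OF B C ab(3)] pw[OF A BC ab(2)] u, symmetric])
    also have "pr (a, t B C (pr (b, u))) = compose (Field (prod_dcpo pr ?AB (P C)))
        (prod_map pr A (prod_dcpo pr B (P C)) (id_map A) (t B C)) (prod_assoc pr A B (P C)) (pr (y, u))"
      using z ab u
      by (simp add: compose_def prod_assoc_def prod_map_def id_map_def
          F[OF A DCPO_prod_dcpo[OF B PC]] F[OF B PC])
    finally show "kl_map \<eta> dag (prod_dcpo pr ?AB C) (prod_dcpo pr A ?BC) (prod_assoc pr A B C)
        (t ?AB C (pr (y, u))) = t A ?BC (compose (Field (prod_dcpo pr ?AB (P C)))
        (prod_map pr A (prod_dcpo pr B (P C)) (id_map A) (t B C)) (prod_assoc pr A B (P C)) (pr (y, u)))" .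
  qed
next
  fix A A' B B' :: "'u rel" and f g :: "'u \<Rightarrow> 'u"
  assume A: "A \<in> DCPO small" and A': "A' \<in> DCPO small" and B: "B \<in> DCPO small" and B': "B' \<in> DCPO small"
    and f: "f \<in> scott_maps A A'" and g: "g \<in> scott_maps B B'"
  note PB = P_DCPO[OF B] and AB = DCPO_prod_dcpo[OF A B] and AB' = DCPO_prod_dcpo[OF A' B']
  show "compose (Field (prod_dcpo pr A (P B)))
      (kl_map \<eta> dag (prod_dcpo pr A B) (prod_dcpo pr A' B') (prod_map pr A B f g)) (t A B)
    = compose (Field (prod_dcpo pr A (P B))) (t A' B') (prod_map pr A (P B) f (kl_map \<eta> dag B B' g))"
    unfolding compose_def
  proof (rule restrict_ext)
    fix z assume z: "z \<in> Field (prod_dcpo pr A (P B))"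
    then obtain a u where au: "z = pr (a, u)" "a \<in> Field A" and u: "u \<in> Field (P B)"
      using Field_prod_dcpo[of A "P B"] A PB by (auto simp: DCPO_dcpo dcpo_refl)
    note fa = scott_maps_Field[OF f au(2)]
    have pa: "pair_with a B \<in> scott_maps B (prod_dcpo pr A B)"
      and pfa: "pair_with (f a) B' \<in> scott_maps B' (prod_dcpo pr A' B')"
      using A A' B B' au fa by (simp_all add: pair_with_scott DCPO_dcpo)
    have fg: "prod_map pr A B f g \<in> scott_maps (prod_dcpo pr A B) (prod_dcpo pr A' B')"
      using A A' B B' f g by (simp add: prod_map_scott DCPO_dcpo)
    have "kl_map \<eta> dag (prod_dcpo pr A B) (prod_dcpo pr A' B') (prod_map pr A B f g) (t A B z)
        = kl_map \<eta> dag B (prod_dcpo pr A' B') (compose (Field B) (prod_map pr A B f g) (pair_with a B)) u"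
      unfolding au(1) t[OF A B au(2) u] by (rule kl_map_kl_map[OF B AB AB' pa fg u])
    \<comment> \<open>The core of naturality: the product of \<open>f\<close> and \<open>g\<close>
      after inserting \<open>a\<close> equals inserting \<open>f a\<close> after
      \<open>g\<close>.\<close>
    also have "compose (Field B) (prod_map pr A B f g) (pair_with a B)
        = compose (Field B) (pair_with (f a) B') g"
      unfolding compose_def using au scott_maps_Field[OF g] A B
      by (intro restrict_ext)
        (simp add: prod_map_def pair_with_def Field_prod_dcpo DCPO_dcpo dcpo_refl)
    also have "kl_map \<eta> dag B (prod_dcpo pr A' B') \<dots> u
        = kl_map \<eta> dag B' (prod_dcpo pr A' B') (pair_with (f a) B') (kl_map \<eta> dag B B' g u)"
      by (rule kl_map_kl_map[OF B B' AB' g pfa u, symmetric])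
    also have "\<dots> = t A' B' (pr (f a, kl_map \<eta> dag B B' g u))"
      by (rule t[OF A' B' fa scott_maps_Field[OF kl_map_scott[OF B B' g] u], symmetric])
    also have "pr (f a, kl_map \<eta> dag B B' g u) = prod_map pr A (P B) f (kl_map \<eta> dag B B' g) z"
      using z au(1) by (simp add: prod_map_def)
    finally show "kl_map \<eta> dag (prod_dcpo pr A B) (prod_dcpo pr A' B') (prod_map pr A B f g) (t A B z)
        = t A' B' (prod_map pr A (P B) f (kl_map \<eta> dag B B' g) z)" .
  qed
qed

end

section \<open>Restriction of the triple and its strength to the closures of the units\<close>

theorem theorem3p9:
  fixes small :: "'u set \<Rightarrow> bool" and pr :: "'u \<times> 'u \<Rightarrow> 'u"
    and T :: "('f, 'i, 'u, 'v) dtheory"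
    and \<Omega> :: "'f \<Rightarrow> 'u rel \<Rightarrow> ('i \<Rightarrow> 'u) set"
    and P Ps :: "'u rel \<Rightarrow> 'u rel"
    and \<eta> \<eta>s :: "'u rel \<Rightarrow> 'u \<Rightarrow> 'u"
    and dag dags :: "'u rel \<Rightarrow> 'u rel \<Rightarrow> ('u \<Rightarrow> 'u) \<Rightarrow> 'u \<Rightarrow> 'u"
    and R Rs :: "'u rel \<Rightarrow> ('f, 'i, 'u) interp"
  assumes "order_universe small pr"
    and "d_algebraic_theory small T"
    and "order_bound_system small T \<Omega>"
    and "kleisli_triple small P \<eta> dag"
    and "arrives_at small (d_algebra small T) (d_morphism T) P dag R"
    and i: "\<And>L. L \<in> DCPO small \<Longrightarrow>
      Ps L = Restr (P L) (obd_closure T \<Omega> (P L) (R L) (\<eta> L ` Field L))"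
    and ii: "\<And>L. L \<in> DCPO small \<Longrightarrow> \<eta>s L = \<eta> L"
    and iii: "\<And>L M f. L \<in> DCPO small \<Longrightarrow> M \<in> DCPO small \<Longrightarrow> f \<in> scott_maps L (Ps M) \<Longrightarrow>
      dags L M f = restrict (dag L M (compose (Field L) (id_map (Ps M)) f)) (Field (Ps L))"
    and iv: "\<And>L f. L \<in> DCPO small \<Longrightarrow> f \<in> Sigma0 T \<union> Sigma1 T \<Longrightarrow>
      Rs L f = restrict (R L f) (admissible T \<Omega> f (Ps L))"
  shows "kleisli_triple small Ps \<eta>s dags
    \<and> arrives_at small (obd_algebra small T \<Omega>) (obd_morphism T \<Omega>) Ps dags Rs
    \<and> (\<forall>t. is_strength small pr P \<eta> dag t
         \<longrightarrow> is_strength small pr Ps \<eta>s dags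
               (\<lambda>A B. restrict (t A B) (Field (prod_dcpo pr A (Ps B)))))"
proof -
  interpret obd_theory small pr T \<Omega>
    using assms(1-3) by (simp add: obd_theory_def obd_theory_axioms_def)
  interpret P: kleisli small pr P \<eta> dag
    using assms(1,4) by (simp add: kleisli_def kleisli_axioms_def)
  have alg: "d_algebra small T (P A) (R A)" if "A \<in> DCPO small" for A
    using assms(5) that by (simp add: arrives_at_def)
  have mor: "d_morphism T (P A) (R A) (P B) (R B) (dag A B f)"
    if "A \<in> DCPO small" "B \<in> DCPO small" "f \<in> scott_maps A (P B)" for A B f
    using assms(5) that by (simp add: arrives_at_def)
  define S where "S A = obd_closure T \<Omega> (P A) (R A) (\<eta> A ` Field A)" for A
  have Ps: "Ps A = Restr (P A) (S A)" if "A \<in> DCPO small" for A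
    using i[OF that] by (simp add: S_def)
  have eta_sub: "\<eta> A ` Field A \<subseteq> Field (P A)" if "A \<in> DCPO small" for A
    using scott_maps_Field[OF P.eta_scott[OF that]] by auto
  have eta_S: "\<eta> A ` Field A \<subseteq> S A" for A
    unfolding S_def by (rule obd_closure_superset)
  have sub: "sub_obd_algebra T \<Omega> (P A) (R A) (S A)" if "A \<in> DCPO small" for A
    unfolding S_def by (rule sub_obd_algebra_closure[OF alg[OF that] eta_sub[OF that]])
  then have sd: "subdcpo (P A) (S A)" if "A \<in> DCPO small" for A
    using that sub_obd_algebra_iff by blast
  have dP: "dcpo (P A)" if "A \<in> DCPO small" for A
    using P.P_DCPO[OF that] by (rule DCPO_dcpo)
  have F: "Field (Ps A) = S A" if "A \<in> DCPO small" for A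
    unfolding Ps[OF that]
    by (rule Refl_Field_Restr2[OF dcpo_refl[OF dP[OF that]] subdcpoD(1)[OF sd[OF that]]])
  have SP: "u \<in> Field (P A)" if "A \<in> DCPO small" "u \<in> S A" for A u
    using subdcpoD(1)[OF sd] that by blast
  have PsD: "Ps A \<in> DCPO small" if "A \<in> DCPO small" for A
    unfolding Ps[OF that] by (rule DCPO_Restr[OF P.P_DCPO[OF that] sd[OF that]])
  \<comment> \<open>The inclusion map disappears from all later typings: the same function serves as
    a map into \<open>Ps B\<close> and into \<open>P B\<close>.\<close>
  have maps: "f \<in> scott_maps A (Ps B) \<longleftrightarrow> f \<in> scott_maps A (P B) \<and> f ` Field A \<subseteq> S B"
    if "A \<in> DCPO small" "B \<in> DCPO small" for A B f
    unfolding Ps[OF that(2)] by (rule scott_maps_Restr_iff[OF DCPO_dcpo[OF that(1)] dP sd]) (rule that(2))+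
  have dag_S: "dag A B f ` S A \<subseteq> S B"
    if A: "A \<in> DCPO small" and B: "B \<in> DCPO small" and f: "f \<in> scott_maps A (Ps B)" for A B f
  proof -
    have f': "f \<in> scott_maps A (P B)" "f ` Field A \<subseteq> S B" using f maps[OF A B] by auto
    \<comment> \<open>On the generators the extension is \<open>f\<close> itself, so the range
      condition on \<open>f\<close> is all that \<open>morphism_closure\<close> has to spread over
      \<open>S A\<close>.\<close>
    have "dag A B f ` \<eta> A ` Field A \<subseteq> S B" using P.dag_unit[OF A B f'(1)] f'(2) by auto
    then show ?thesis
      unfolding S_def[of A]
      by (rule morphism_closure[OF alg[OF A] alg[OF B] mor[OF A B f'(1)] sub[OF B] eta_sub[OF A]])
  qed
  have dags: "dags A B f = restrict (dag A B f) (S A)"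
    if A: "A \<in> DCPO small" and B: "B \<in> DCPO small" and f: "f \<in> scott_maps A (Ps B)" for A B f
  proof -
    \<comment> \<open>Composing with the inclusion changes nothing: \<open>f\<close> is extensional
      and its values lie where \<open>id_map (Ps B)\<close> is the identity.\<close>
    have "compose (Field A) (id_map (Ps B)) f = restrict f (Field A)"
      unfolding compose_def using scott_maps_Field[OF f] by (intro restrict_ext) (simp add: id_map_def)
    then have "compose (Field A) (id_map (Ps B)) f = f"
      using extensional_restrict[OF scott_maps_extensional[OF f]] by simp
    then show ?thesis using iii[OF A B f] F[OF A] by simp
  qed
  have eta_Ps: "\<eta> A \<in> scott_maps A (Ps A)" if "A \<in> DCPO small" for A
    using maps[OF that that] P.eta_scott[OF that] eta_S by blast
  have dags_Ps: "dags A B f \<in> scott_maps (Ps A) (Ps B)"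
    if A: "A \<in> DCPO small" and B: "B \<in> DCPO small" and f: "f \<in> scott_maps A (Ps B)" for A B f
  proof -
    have "f \<in> scott_maps A (P B)" using f maps[OF A B] by simp
    then have "restrict (dag A B f) (S A) \<in> scott_maps (Ps A) (P B)"
      unfolding Ps[OF A] by (intro scott_maps_restrict[OF dP[OF A] sd[OF A]] P.dag_scott A B)
    then show ?thesis
      unfolding maps[OF PsD[OF A] B] dags[OF A B f] using dag_S[OF A B f] F[OF A] by auto
  qed
  have Ps_kleisli: "kleisli_triple small Ps \<eta>s dags"
    unfolding kleisli_triple_def
  proof (intro conjI ballI)
    fix A assume A: "A \<in> DCPO small"
    show "Ps A \<in> DCPO small" by (rule PsD[OF A])
    show "\<eta>s A \<in> scott_maps A (Ps A)" using eta_Ps[OF A] ii[OF A] by simp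
    show "dags A A (\<eta>s A) = (\<lambda>u\<in>Field (Ps A). u)"
      unfolding ii[OF A] dags[OF A A eta_Ps[OF A]] P.dag_eta[OF A] F[OF A]
      using SP[OF A] by (intro restrict_ext) simp
    fix B assume B: "B \<in> DCPO small"
    {
      fix f assume f: "f \<in> scott_maps A (Ps B)"
      show "dags A B f \<in> scott_maps (Ps A) (Ps B)" by (rule dags_Ps[OF A B f])
      \<comment> \<open>Units lie in \<open>S A\<close>, so cutting the extension down to
        \<open>S A\<close> is invisible here.\<close>
      have "compose (Field A) (dags A B f) (\<eta>s A) = compose (Field A) (dag A B f) (\<eta> A)"
        unfolding ii[OF A] dags[OF A B f] compose_def
        using eta_S[of A] by (intro restrict_ext) auto
      then show "compose (Field A) (dags A B f) (\<eta>s A) = f"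
        using P.dag_compose_eta[OF A B] f maps[OF A B] by simp
    }
    fix C g f assume C: "C \<in> DCPO small" and g: "g \<in> scott_maps A (Ps B)" and f: "f \<in> scott_maps B (Ps C)"
    have g': "g \<in> scott_maps A (P B)" "g ` Field A \<subseteq> S B" using g maps[OF A B] by auto
    have f': "f \<in> scott_maps B (P C)" using f maps[OF B C] by simp
    have fg: "compose (Field A) (dags B C f) g = compose (Field A) (dag B C f) g"
      unfolding dags[OF B C f] compose_def using g'(2) by (intro restrict_ext) auto
    have *: "compose (Field A) (dags B C f) g \<in> scott_maps A (Ps C)"
      by (rule scott_maps_compose[OF DCPO_dcpo[OF A] g dags_Ps[OF B C f]])
    \<comment> \<open>At a point of \<open>S A\<close> the inner extension lands in
      \<open>S B\<close> by \<open>dag_S\<close>, so the outer restriction is invisible and the law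
      is that of \<open>P\<close>.\<close>
    show "compose (Field (Ps A)) (dags B C f) (dags A B g) = dags A C (compose (Field A) (dags B C f) g)"
      unfolding dags[OF A C *] unfolding fg
      unfolding dags[OF A B g] dags[OF B C f] F[OF A] compose_def[of "S A"]
      using dag_S[OF A B g] P.dag_dag[OF A B C g'(1) f' SP[OF A]] by (intro restrict_ext) auto
  qed
  have Rs: "Rs A f = restrict (R A f) (admissible T \<Omega> f (Restr (P A) (S A)))"
    if "A \<in> DCPO small" "f \<in> Sigma0 T \<union> Sigma1 T" for A f
    using iv[OF that] Ps[OF that(1)] by simp
  have Rs_arrives: "arrives_at small (obd_algebra small T \<Omega>) (obd_morphism T \<Omega>) Ps dags Rs"
    unfolding arrives_at_def
  proof (intro conjI ballI)
    fix A assume A: "A \<in> DCPO small"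
    show "obd_algebra small T \<Omega> (Ps A) (Rs A)"
      unfolding Ps[OF A] by (rule obd_algebra_sub[OF alg[OF A] sub[OF A] Rs[OF A]])
    fix B f assume B: "B \<in> DCPO small" and f: "f \<in> scott_maps A (Ps B)"
    have f': "f \<in> scott_maps A (P B)" using f maps[OF A B] by simp
    show "obd_morphism T \<Omega> (Ps A) (Rs A) (Ps B) (Rs B) (dags A B f)"
      using obd_morphism_sub[OF P.P_DCPO[OF A] sub[OF A] P.P_DCPO[OF B] sub[OF B] Rs[OF A] Rs[OF B]
          mor[OF A B f']] dags_Ps[OF A B f]
      by (simp add: dags[OF A B f] Ps[OF A] Ps[OF B])
  qed
  interpret Ps: kleisli small pr Ps \<eta>s dags
    by (simp add: kleisli_def kleisli_axioms_def Ps_kleisli order_universe_axioms)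
  have "is_strength small pr Ps \<eta>s dags (\<lambda>A B. restrict (t A B) (Field (prod_dcpo pr A (Ps B))))"
    if t: "is_strength small pr P \<eta> dag t" for t
  proof (rule Ps.is_strengthI)
    have FX: "Field (prod_dcpo pr A (Ps B)) = pr ` (Field A \<times> S B)"
      if "A \<in> DCPO small" "B \<in> DCPO small" for A B
      using Field_prod_dcpo[OF dcpo_refl[OF DCPO_dcpo] dcpo_refl[OF DCPO_dcpo[OF PsD]]] that F by simp
    \<comment> \<open>The two functor actions agree on \<open>S B\<close>: the unit is unchanged and
      \<open>dags\<close> only restricts. The formula for \<open>P\<close> thus becomes the formula
      for \<open>Ps\<close>.\<close>
    have tS: "t A B (pr (a, u)) = kl_map \<eta>s dags B (prod_dcpo pr A B) (pair_with a B) u"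
      if A: "A \<in> DCPO small" and B: "B \<in> DCPO small" and a: "a \<in> Field A" and u: "u \<in> S B"
      for A B a u
    proof -
      let ?AB = "prod_dcpo pr A B"
      note AB = DCPO_prod_dcpo[OF A B]
      note p = pair_with_scott[OF DCPO_dcpo[OF A] DCPO_dcpo[OF B] a]
      have "compose (Field B) (\<eta> ?AB) (pair_with a B) \<in> scott_maps B (Ps ?AB)"
        using Ps.eta_compose_scott[OF B AB p] ii[OF AB] by simp
      then have "kl_map \<eta>s dags B ?AB (pair_with a B) u = kl_map \<eta> dag B ?AB (pair_with a B) u"
        unfolding kl_map_def ii[OF AB] using u by (simp add: dags[OF B AB])
      then show ?thesis using P.is_strength_apply[OF t A B a SP[OF B u]] by simp
    qed
    fix A B assume A: "A \<in> DCPO small" and B: "B \<in> DCPO small"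
    note AB = DCPO_prod_dcpo[OF A B]
    show "restrict (t A B) (Field (prod_dcpo pr A (Ps B))) (pr (a, u))
        = kl_map \<eta>s dags B (prod_dcpo pr A B) (pair_with a B) u"
      if "a \<in> Field A" "u \<in> Field (Ps B)" for a u
      using tS[OF A B] that F[OF B] FX[OF A B] by simp
    have "t A B \<in> scott_maps (prod_dcpo pr A (P B)) (P (prod_dcpo pr A B))"
      using t A B by (simp add: is_strength_def)
    \<comment> \<open>Joint continuity is inherited, since the new source is a subdcpo of the old
      one with the induced order.\<close>
    then have "restrict (t A B) (Field (prod_dcpo pr A (Ps B)))
        \<in> scott_maps (prod_dcpo pr A (Ps B)) (P (prod_dcpo pr A B))"
      unfolding FX[OF A B] unfolding Ps[OF B] prod_dcpo_Restr
      by (intro scott_maps_restrict subdcpo_prod_dcpo dcpo_prod_dcpo DCPO_dcpo[OF A] dP[OF B] sd[OF B])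
    \<comment> \<open>That \<open>t\<close> respects the closures takes no second closure argument:
      by \<open>tS\<close> the value is a functor action of \<open>Ps\<close>, which ends in the
      carrier of \<open>Ps\<close> at the product.\<close>
    moreover have "t A B (pr (a, u)) \<in> S (prod_dcpo pr A B)" if "a \<in> Field A" "u \<in> S B" for a u
      using scott_maps_Field[OF Ps.kl_map_scott[OF B AB
            pair_with_scott[OF DCPO_dcpo[OF A] DCPO_dcpo[OF B] that(1)]], of u]
        tS[OF A B that] that(2) F[OF B] F[OF AB] by simp
    ultimately show "restrict (t A B) (Field (prod_dcpo pr A (Ps B)))
        \<in> scott_maps (prod_dcpo pr A (Ps B)) (Ps (prod_dcpo pr A B))"
      unfolding maps[OF DCPO_prod_dcpo[OF A PsD[OF B]] AB] by (auto simp: FX[OF A B])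
  qed
  then show ?thesis using Ps_kleisli Rs_arrives by blast
qed

end
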